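(* Let $\hat A=A_s+A_d\epsilon\in\mathbb{DQ}^{n\times n}$ be a dual quaternion matrix and let $\lambda_{1s},\dots,\lambda_{ms}\in\mathbb{C}$ be the distinct standard eigenvalues of $A_s$. Assume that $$|\lambda_{1s}|>|\lambda_{2s}|\ge\cdots\ge|\lambda_{ms}|\quad\text{and}\quad \mathtt m_a(\lambda_{1s},A_s)=\mathtt m_g(\lambda_{1s},A_s).$$ Then $\hat A$ has at least one eigenvalue whose standard part is $\lambda_{1s}$. Furthermore, the number of eigenvalues of $\hat A$ whose standard part lies in $[\lambda_{1s}]$ is finite.
   Context: $\mathbb{Q}$ denotes the quaternions and $\mathbb{DQ}$ the dual quaternions $\hat q=q_s+q_d\epsilon$, $q_s,q_d\in\mathbb Q$, where $\epsilon\neq0$, $\epsilon^2=0$ and $\epsilon$ commutes with quaternions; $q_s$ is the standard part and $q_d$ the dual part. The same notation is used entrywise for vectors and matrices ($\hat A=A_s+A_d\epsilon$). A dual quaternion vector is appreciable if its standard part is nonzero. A dual quaternion $\hat\lambda$ is a (right) eigenvalue of $\hat A\in\mathbb{DQ}^{n\times n}$ if $\hat A\hat{\mathbf x}=\hat{\mathbf x}\hat\lambda$ for some appreciable $\hat{\mathbf x}\in\mathbb{DQ}^n$; similarly $\lambda\in\mathbb Q$ is a (right) eigenvalue of $A_s\in\mathbb Q^{n\times n}$ if $A_s\mathbf x=\mathbf x\lambda$ for some nonzero $\mathbf x\in\mathbb Q^n$. Quaternions $p,q$ are similar if $p=u^{-1}qu$ for some invertible quaternion $u$; $[q]$ is the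 similarity class of $q$. A standard eigenvalue of a quaternion matrix is an eigenvalue that is a complex number with nonnegative imaginary part. Every $A\in\mathbb Q^{n\times n}$ is similar, via an invertible quaternion matrix, to a block diagonal matrix of Jordan blocks whose diagonal entries are the standard eigenvalues of $A$ (its Jordan canonical form, unique up to the order of blocks). $\mathtt m_a(\lambda,A)$ (algebraic multiplicity) is the sum of the sizes of the Jordan blocks with standard eigenvalue $\lambda$, and $\mathtt m_g(\lambda,A)$ (geometric multiplicity) is the number of such blocks.
   Formalization: The number of eigenvalues with standard part in [λ_1s] is counted up to similarity by invertible dual quaternions; the literal count can be infinite, e.g. for the 1×1 matrix i, where every u^{-1} i u is an eigenvalue. *)

theory Defs
  imports Complex_Main "Jordan_Normal_Form.Jordan_Normal_Form"
begin

section \<open>Quaternions\<close>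

text \<open>\<open>Quat a b c d\<close> is the quaternion a + b i + c j + d k.\<close>

datatype quat = Quat (qre: real) (qim_i: real) (qim_j: real) (qim_k: real)

instantiation quat :: division_ring
begin

definition "0 = Quat 0 0 0 0"
definition "1 = Quat 1 0 0 0"
definition "p + q = Quat (qre p + qre q) (qim_i p + qim_i q) (qim_j p + qim_j q) (qim_k p + qim_k q)"
definition "p - q = Quat (qre p - qre q) (qim_i p - qim_i q) (qim_j p - qim_j q) (qim_k p - qim_k q)"
definition "- q = Quat (- qre q) (- qim_i q) (- qim_j q) (- qim_k q)"
definition "p * q = Quat
  (qre p * qre q - qim_i p * qim_i q - qim_j p * qim_j q - qim_k p * qim_k q)
  (qre p * qim_i q + qim_i p * qre q + qim_j p * qim_k q - qim_k p * qim_j q)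
  (qre p * qim_j q - qim_i p * qim_k q + qim_j p * qre q + qim_k p * qim_i q)
  (qre p * qim_k q + qim_i p * qim_j q - qim_j p * qim_i q + qim_k p * qre q)"
definition "inverse q =
  (let N = (qre q)\<^sup>2 + (qim_i q)\<^sup>2 + (qim_j q)\<^sup>2 + (qim_k q)\<^sup>2
   in Quat (qre q / N) (- qim_i q / N) (- qim_j q / N) (- qim_k q / N))"
definition "p div q = p * inverse (q :: quat)"

lemmas quat_defs = zero_quat_def one_quat_def plus_quat_def minus_quat_def uminus_quat_def
  times_quat_def

instance
proof
  fix q :: quat
  assume "q \<noteq> 0"
  define N where "N = (qre q)\<^sup>2 + (qim_i q)\<^sup>2 + (qim_j q)\<^sup>2 + (qim_k q)\<^sup>2"
  have "N \<noteq> 0"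
  proof
    assume "N = 0"
    then have "(qre q)\<^sup>2 = 0" "(qim_i q)\<^sup>2 = 0" "(qim_j q)\<^sup>2 = 0" "(qim_k q)\<^sup>2 = 0"
      unfolding N_def
      using zero_le_power2[of "qre q"] zero_le_power2[of "qim_i q"]
        zero_le_power2[of "qim_j q"] zero_le_power2[of "qim_k q"] by linarith+
    then show False
      using \<open>q \<noteq> 0\<close> by (cases q) (simp add: zero_quat_def)
  qed
  have inv: "inverse q = Quat (qre q / N) (- qim_i q / N) (- qim_j q / N) (- qim_k q / N)"
    by (simp add: inverse_quat_def N_def Let_def)
  have "qre q * qre q / N + qim_i q * qim_i q / N + qim_j q * qim_j q / N + qim_k q * qim_k q / N
      = N / N"
    by (simp only: N_def power2_eq_square add_divide_distrib)
  then have "qre q * qre q / N + qim_i q * qim_i q / N + qim_j q * qim_j q / N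
      + qim_k q * qim_k q / N = 1"
    using \<open>N \<noteq> 0\<close> by simp
  then show "inverse q * q = 1" "q * inverse q = 1"
    by (simp_all add: inv times_quat_def one_quat_def algebra_simps)
qed (simp_all add: quat_defs divide_quat_def inverse_quat_def algebra_simps quat.expand)

end

definition quat_of_complex :: "complex \<Rightarrow> quat" where
  "quat_of_complex z = Quat (Re z) (Im z) 0 0"


section \<open>Dual quaternions\<close>

text \<open>\<open>DQuat p q\<close> is the dual quaternion with standard part p and dual part q.\<close>

datatype dquat = DQuat (std_part: quat) (dual_part: quat)

instantiation dquat :: ring_1
begin

definition "0 = DQuat 0 0"
definition "1 = DQuat 1 0"
definition "x + y = DQuat (std_part x + std_part y) (dual_part x + dual_part y)"
definition "x - y = DQuat (std_part x - std_part y) (dual_part x - dual_part y)"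
definition "- x = DQuat (- std_part x) (- dual_part x)"
definition "x * y = DQuat (std_part x * std_part y)
                          (std_part x * dual_part y + dual_part x * std_part y)"

lemmas dquat_defs = zero_dquat_def one_dquat_def plus_dquat_def minus_dquat_def
  uminus_dquat_def times_dquat_def

instance
  by standard (simp_all add: dquat_defs algebra_simps dquat.expand)

end

definition dquat_of_quat :: "quat \<Rightarrow> dquat" where
  "dquat_of_quat q = DQuat q 0"

definition dual_eps :: dquat where
  "dual_eps = DQuat 0 1"

lemma dual_eps_nonzero: "dual_eps \<noteq> 0"
  by (simp add: dual_eps_def zero_dquat_def)

lemma dual_eps_square: "dual_eps * dual_eps = 0"
  by (simp add: dual_eps_def dquat_defs)

lemma dual_eps_commute: "dual_eps * dquat_of_quat q = dquat_of_quat q * dual_eps"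
  by (simp add: dual_eps_def dquat_of_quat_def dquat_defs)

lemma DQuat_eq: "DQuat p q = dquat_of_quat p + dquat_of_quat q * dual_eps"
  by (simp add: dual_eps_def dquat_of_quat_def dquat_defs)


section \<open>Similarity\<close>

text \<open>
  The definition is used at type \<^typ>\<open>quat\<close>, where it is \<open>[q]\<close>, and at type \<^typ>\<open>dquat\<close>,
  where the invertible elements are exactly the dual quaternions with nonzero standard part.
\<close>

definition sim_class :: "'a :: monoid_mult \<Rightarrow> 'a set" where
  "sim_class q = {p. \<exists>u v. u * v = 1 \<and> v * u = 1 \<and> p = v * q * u}"


section \<open>Right eigenvalues\<close>

definition vec_rmult :: "'a :: times vec \<Rightarrow> 'a \<Rightarrow> 'a vec" where
  "vec_rmult x a = map_vec (\<lambda>y. y * a) x"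

definition right_eigenvalue :: "quat mat \<Rightarrow> quat \<Rightarrow> bool" where
  "right_eigenvalue A a \<longleftrightarrow>
     (\<exists>x \<in> carrier_vec (dim_row A). x \<noteq> 0\<^sub>v (dim_row A) \<and> A *\<^sub>v x = vec_rmult x a)"

definition appreciable :: "dquat vec \<Rightarrow> bool" where
  "appreciable x \<longleftrightarrow> map_vec std_part x \<noteq> 0\<^sub>v (dim_vec x)"

definition dual_right_eigenvalue :: "dquat mat \<Rightarrow> dquat \<Rightarrow> bool" where
  "dual_right_eigenvalue A a \<longleftrightarrow>
     (\<exists>x \<in> carrier_vec (dim_row A). appreciable x \<and> A *\<^sub>v x = vec_rmult x a)"

definition standard_eigenvalue :: "quat mat \<Rightarrow> complex \<Rightarrow> bool" where
  "standard_eigenvalue A z \<longleftrightarrow> 0 \<le> Im z \<and> right_eigenvalue A (quat_of_complex z)"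


section \<open>Jordan canonical form and multiplicities\<close>

text \<open>A Jordan form is encoded, as in \<^const>\<open>jordan_nf\<close>, by its list of (block size, eigenvalue).\<close>

definition quat_jordan_nf :: "quat mat \<Rightarrow> (nat \<times> complex) list \<Rightarrow> bool" where
  "quat_jordan_nf A bs \<longleftrightarrow>
     jordan_nf A (map (\<lambda>(k, z). (k, quat_of_complex z)) bs) \<and>
     (\<forall>(k, z) \<in> set bs. standard_eigenvalue A z)"

text \<open>
  Every square quaternion matrix has such a form, unique up to the order of the blocks, so the
  multiplicities below do not depend on the choice.
\<close>

definition jordan_blocks :: "quat mat \<Rightarrow> (nat \<times> complex) list" where
  "jordan_blocks A = (SOME bs. quat_jordan_nf A bs)"

definition alg_mult :: "complex \<Rightarrow> quat mat \<Rightarrow> nat" where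
  "alg_mult z A = sum_list (map fst (filter (\<lambda>b. snd b = z) (jordan_blocks A)))"

definition geo_mult :: "complex \<Rightarrow> quat mat \<Rightarrow> nat" where
  "geo_mult z A = length (filter (\<lambda>b. snd b = z) (jordan_blocks A))"

end

theory Submission
  imports Defs "Jordan_Normal_Form.Spectral_Radius"
begin

text \<open>
  Let $A_s$ and $A_d$ be the standard and the dual part of the matrix and $\lambda =
  \lambda_{1s}$. A dual quaternion $\mu + \nu\epsilon$ is an eigenvalue if and only if $A_s x
  = x\mu$ and $A_s y + A_d x = y\mu + x\nu$ for some $x \neq 0$ and some $y$. Up to similarity
  $\mu = \lambda$.

  As algebraic and geometric multiplicity agree, all Jordan blocks of $\lambda$ have size one,
  so in a suitable basis $A_s = \lambda I_k \oplus J$, where no eigenvalue of $J$ is similar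
  to $\lambda$ (\<open>semisimple_eigenvalue_compression\<close>). On the second summand the
  operator $x \mapsto J x - x\lambda$ is bijective, so the equations there determine the
  components of $x$ and $y$ without restricting $\nu$. On the first summand there remains,
  with $B$ the upper left block of $A_d$ in this basis, $\lambda w - w\lambda + B x = x\nu$, $\lambda
  x = x\lambda$, $x \neq 0$ (\<open>dual_eigenpair_block\<close>). If $\lambda$ is
  real, $\nu$ is just a right eigenvalue of $B$ (\<open>compressed_eigenvalues_real\<close>).
  If not, $x$ is complex and $\lambda w - w\lambda$ is an arbitrary vector over $\mathbb{C}
  j$, so that the complex part of $\nu$ is an eigenvalue of the complex part of $B$; the
  $j$-part of $\nu$ is arbitrary, but conjugation by $1 + v\epsilon$ removes it
  (\<open>compressed_eigenvalues_nonreal\<close>). In both cases such $\nu$ exist, and they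
  give finitely many similarity classes.

  The multiplicities refer to a Jordan form, so the existence of the Jordan form of a
  quaternion matrix has to be established (\<open>quat_jordan_nf_exists\<close>). It is proved by induction on the size: a left
  eigenvector, found from a complex matrix of twice the size, yields an invariant subspace of
  codimension one, which has a Jordan basis, and a vector $v$ with $A v - v z$ in that
  subspace. Changing $v$ within the subspace removes everything from $A v - v z$ except the
  heads of the chains of $z$, with coefficients that commute with $z$; the longest chain that
  occurs is prolonged by $v$, and the new chain absorbs the heads of the others
  (\<open>bordered_jordan\<close>).
\<close>

section \<open>Similarity by permutations\<close>

lemma similar_mat_permute:
  fixes A :: "'a :: semiring_1 mat"
  assumes A: "A \<in> carrier_mat n n"
    and f: "\<And>i. i < n \<Longrightarrow> f i < n" and g: "\<And>i. i < n \<Longrightarrow> g i < n"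
    and gf: "\<And>i. i < n \<Longrightarrow> g (f i) = i" and fg: "\<And>i. i < n \<Longrightarrow> f (g i) = i"
  shows "similar_mat_wit (mat n n (\<lambda>(i, j). A $$ (f i, f j))) A
    (mat n n (\<lambda>(i, j). if j = f i then 1 else 0)) (mat n n (\<lambda>(i, j). if i = f j then 1 else 0))"
    (is "similar_mat_wit ?B A ?P ?Q")
proof (rule similar_mat_witI)
  show "?P * ?Q = 1\<^sub>m n"
  proof (rule eq_matI)
    fix i j assume ij: "i < dim_row (1\<^sub>m n :: 'a mat)" "j < dim_col (1\<^sub>m n :: 'a mat)"
    then have "f i = f j \<longleftrightarrow> i = j" using gf by (metis index_one_mat(2) index_one_mat(3))
    then show "(?P * ?Q) $$ (i, j) = 1\<^sub>m n $$ (i, j)"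
      using ij f by (auto simp: scalar_prod_def if_distrib[of "\<lambda>x. x * _"] cong: if_cong)
  qed auto
  show "?Q * ?P = 1\<^sub>m n"
  proof (rule eq_matI)
    fix i j assume ij: "i < dim_row (1\<^sub>m n :: 'a mat)" "j < dim_col (1\<^sub>m n :: 'a mat)"
    have "(\<Sum>r\<in>{0..<n}. (if i = f r then 1 else 0) * (if j = f r then 1 else 0 :: 'a))
        = (\<Sum>r\<in>{0..<n}. if r = g i then (if i = j then 1 else 0) else 0)"
      by (rule sum.cong) (use fg gf ij in auto)
    then show "(?Q * ?P) $$ (i, j) = 1\<^sub>m n $$ (i, j)"
      using ij g by (auto simp: scalar_prod_def)
  qed auto
  show "?B = ?P * A * ?Q"
  proof (rule eq_matI)
    fix i j assume ij: "i < dim_row (?P * A * ?Q)" "j < dim_col (?P * A * ?Q)"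
    have 1: "(?P * A) $$ (i, r) = A $$ (f i, r)" if "r < n" for r
      using ij that A f by (auto simp: scalar_prod_def if_distrib[of "\<lambda>x. x * _"] cong: if_cong)
    have "(?P * A * ?Q) $$ (i, j) = (\<Sum>r\<in>{0..<n}. (?P * A) $$ (i, r) * ?Q $$ (r, j))"
      using ij A by (auto simp: scalar_prod_def simp del: index_mult_mat(1)) 
       (subst index_mult_mat(1), auto simp: scalar_prod_def simp del: index_mult_mat(1))
    also have "\<dots> = (\<Sum>r\<in>{0..<n}. if r = f j then A $$ (f i, r) else 0)"
      by (rule sum.cong) (use ij in \<open>auto simp: 1 simp del: index_mult_mat(1)\<close>)
    finally show "?B $$ (i, j) = (?P * A * ?Q) $$ (i, j)"
      using ij f by (simp del: index_mult_mat(1))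
  qed (use A in auto)
qed (use A in auto)

section \<open>Similarities that fix the last coordinate functional\<close>

text \<open>
  The Jordan form is built by bordering: a Jordan matrix $J$ is enlarged by one new basis
  vector $v$ with $A v = v z + u$, $u$ in the old space. In matrix terms the interaction of a
  block with all the others is then confined to the column of $v$, and this shape has to
  survive further changes of basis. It does when the change of basis keeps the last coordinate
  functional, that is, when the last row of the transition matrix is the last unit vector.
\<close>

definition lastcol :: "nat \<Rightarrow> nat \<Rightarrow> (nat \<Rightarrow> 'a :: zero) \<Rightarrow> 'a mat" where
  "lastcol l k c = mat l k (\<lambda>(i, j). if Suc j = k then c i else 0)"

lemma lastcol_carrier [simp]: "lastcol l k c \<in> carrier_mat l k"
  and lastcol_dim [simp]: "dim_row (lastcol l k c) = l" "dim_col (lastcol l k c) = k"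
  and lastcol_index [simp]:
    "i < l \<Longrightarrow> j < k \<Longrightarrow> lastcol l k c $$ (i, j) = (if Suc j = k then c i else 0)"
  by (auto simp: lastcol_def)

definition last_row_unit :: "'a :: {zero,one} mat \<Rightarrow> bool" where
  "last_row_unit P \<longleftrightarrow>
     (\<forall>j < dim_col P. P $$ (dim_row P - 1, j) = (if Suc j = dim_col P then 1 else 0))"

lemma last_row_unit_one: "last_row_unit (1\<^sub>m n)"
  by (auto simp: last_row_unit_def)

lemma lastcol_times:
  fixes Q :: "'a :: semiring_1 mat"
  assumes Q: "Q \<in> carrier_mat k k" and "last_row_unit Q"
  shows "lastcol l k c * Q = lastcol l k c"
proof (rule eq_matI)
  fix i j assume ij: "i < dim_row (lastcol l k c)" "j < dim_col (lastcol l k c)"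
  have "(lastcol l k c * Q) $$ (i, j) = (\<Sum>r\<in>{0..<k}. (if Suc r = k then c i else 0) * Q $$ (r, j))"
    using ij Q by (auto simp: scalar_prod_def)
  also have "\<dots> = (\<Sum>r\<in>{0..<k}. if r = k - 1 then c i * Q $$ (k - 1, j) else 0)"
    by (rule sum.cong) auto
  also have "\<dots> = lastcol l k c $$ (i, j)"
    using ij assms by (auto simp: last_row_unit_def)
  finally show "(lastcol l k c * Q) $$ (i, j) = lastcol l k c $$ (i, j)" .
qed (use Q in auto)

lemma last_row_unit_mult:
  fixes P Q :: "'a :: semiring_1 mat"
  assumes P: "P \<in> carrier_mat n n" and Q: "Q \<in> carrier_mat n n"
    and "last_row_unit P" "last_row_unit Q"
  shows "last_row_unit (P * Q)"
  unfolding last_row_unit_def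
proof (intro allI impI)
  fix j assume "j < dim_col (P * Q)"
  then have j: "j < n" using Q by auto
  have "(P * Q) $$ (n - 1, j) = (\<Sum>r\<in>{0..<n}. P $$ (n - 1, r) * Q $$ (r, j))"
    using P Q j by (auto simp: scalar_prod_def)
  also have "\<dots> = (\<Sum>r\<in>{0..<n}. if r = n - 1 then Q $$ (n - 1, j) else 0)"
    by (rule sum.cong) (use assms in \<open>auto simp: last_row_unit_def\<close>)
  also have "\<dots> = (if Suc j = n then 1 else 0)"
    using assms j by (auto simp: last_row_unit_def)
  finally show "(P * Q) $$ (dim_row (P * Q) - 1, j) = (if Suc j = dim_col (P * Q) then 1 else 0)"
    using P Q by auto
qed

definition similar_fixing_last :: "'a :: semiring_1 mat \<Rightarrow> 'a mat \<Rightarrow> bool" where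
  "similar_fixing_last A B \<longleftrightarrow>
     (\<exists>P Q. similar_mat_wit A B P Q \<and> last_row_unit P \<and> last_row_unit Q)"

lemma similar_fixing_lastI:
  "similar_mat_wit A B P Q \<Longrightarrow> last_row_unit P \<Longrightarrow> last_row_unit Q \<Longrightarrow> similar_fixing_last A B"
  by (auto simp: similar_fixing_last_def)

lemma similar_fixing_last_imp_similar: "similar_fixing_last A B \<Longrightarrow> similar_mat A B"
  by (auto simp: similar_fixing_last_def similar_mat_def)

lemma similar_fixing_last_refl: "A \<in> carrier_mat n n \<Longrightarrow> similar_fixing_last A A"
  using similar_mat_wit_refl last_row_unit_one similar_fixing_lastI by blast

lemma similar_fixing_last_trans [trans]:
  assumes "similar_fixing_last A B" "similar_fixing_last B C"
  shows "similar_fixing_last A C"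
proof -
  obtain P Q P' Q' where 1: "similar_mat_wit A B P Q" "last_row_unit P" "last_row_unit Q"
    and 2: "similar_mat_wit B C P' Q'" "last_row_unit P'" "last_row_unit Q'"
    using assms by (auto simp: similar_fixing_last_def)
  have A: "A \<in> carrier_mat (dim_row A) (dim_row A)" and B: "B \<in> carrier_mat (dim_row A) (dim_row A)"
    using similar_mat_witD(4,5)[OF refl 1(1)] .
  note w = similar_mat_witD2[OF A 1(1)] similar_mat_witD2[OF B 2(1)]
  show ?thesis
    using similar_fixing_lastI[OF similar_mat_wit_trans[OF 1(1) 2(1)]]
      last_row_unit_mult[OF w(6) w(13) 1(2) 2(2)] last_row_unit_mult[OF w(14) w(7) 2(3) 1(3)] .
qed

lemma last_row_unit_four_block:
  assumes "P \<in> carrier_mat m m" "0 < m" "last_row_unit P" "R \<in> carrier_mat n n"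
  shows "last_row_unit (four_block_mat R X (0\<^sub>m m n) P)"
  unfolding last_row_unit_def
proof (intro allI impI)
  fix j assume "j < dim_col (four_block_mat R X (0\<^sub>m m n) P)"
  then have j: "j < n + m" using assms(1,4) by simp
  have row: "P $$ (m - 1, i) = (if Suc i = m then 1 else 0)" if "i < m" for i
    using assms(1,3) that by (simp add: last_row_unit_def)
  have e: "n + m - 1 - n = m - 1" "\<not> n + m - 1 < n" "n + m - 1 < n + m" using assms(2) by auto
  have "four_block_mat R X (0\<^sub>m m n) P $$ (n + m - 1, j) = (if Suc j = n + m then 1 else 0)"
  proof (cases "j < n")
    case True
    then show ?thesis using assms(1,2,4) e by (subst index_mat_four_block(1)) auto
  next
    case False
    then have "j - n < m" "Suc (j - n) = m \<longleftrightarrow> Suc j = n + m" using j by auto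
    then show ?thesis
      using assms(1,4) e j False row[of "j - n"] by (subst index_mat_four_block(1)) simp_all
  qed
  then show "four_block_mat R X (0\<^sub>m m n) P $$ (dim_row (four_block_mat R X (0\<^sub>m m n) P) - 1, j)
      = (if Suc j = dim_col (four_block_mat R X (0\<^sub>m m n) P) then 1 else 0)"
    using assms(1,4) by simp
qed

lemma similar_fixing_last_four_block:
  fixes A :: "'a :: semiring_1 mat"
  assumes A: "A \<in> carrier_mat l l" and T: "T \<in> carrier_mat m m" and m: "0 < m"
    and sim: "similar_fixing_last T T'"
  shows "similar_fixing_last (four_block_mat A (lastcol l m c) (0\<^sub>m m l) T)
                             (four_block_mat A (lastcol l m c) (0\<^sub>m m l) T')"
proof -
  obtain P Q where PQ: "similar_mat_wit T T' P Q" "last_row_unit P" "last_row_unit Q"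
    using sim by (auto simp: similar_fixing_last_def)
  note w = similar_mat_witD2[OF T PQ(1)]
  have "similar_mat_wit (four_block_mat A (lastcol l m c) (0\<^sub>m m l) T)
     (four_block_mat A (lastcol l m c) (0\<^sub>m m l) T')
     (four_block_mat (1\<^sub>m l) (0\<^sub>m l m) (0\<^sub>m m l) P) (four_block_mat (1\<^sub>m l) (0\<^sub>m l m) (0\<^sub>m m l) Q)"
    by (rule similar_mat_wit_four_block[OF similar_mat_wit_refl[OF A] PQ(1)])
      (use A T lastcol_times[OF w(7) PQ(3)] in \<open>auto simp: left_mult_one_mat[of _ l m] right_mult_zero_mat[OF w(6)] left_mult_zero_mat\<close>)
  then show ?thesis
    by (rule similar_fixing_lastI)
      (rule last_row_unit_four_block[of _ m _ l], use w(6,7) PQ(2,3) m in auto)+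
qed

text \<open>
  Conjugation by the unipotent matrix with corner $X$: the
  corner can be changed by anything in the image of the Sylvester operator $X \mapsto A X - X
  D$. The whole construction of the Jordan form consists in choosing $X$ well.
\<close>

lemma similar_fixing_last_shear:
  fixes A :: "'a :: ring_1 mat"
  assumes A: "A \<in> carrier_mat l l" and B: "B \<in> carrier_mat l m" and D: "D \<in> carrier_mat m m"
    and X: "X \<in> carrier_mat l m" and m: "0 < m"
  shows "similar_fixing_last (four_block_mat A B (0\<^sub>m m l) D)
                             (four_block_mat A (B + (A * X - X * D)) (0\<^sub>m m l) D)"
proof -
  let ?P = "four_block_mat (1\<^sub>m l) X (0\<^sub>m m l) (1\<^sub>m m)"
  let ?Q = "four_block_mat (1\<^sub>m l) (- X) (0\<^sub>m m l) (1\<^sub>m m)"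
  let ?M = "four_block_mat A B (0\<^sub>m m l) D"
  let ?N = "four_block_mat A (B + (A * X - X * D)) (0\<^sub>m m l) D"
  have dims [simp]: "dim_row A = l" "dim_col A = l" "dim_row B = l" "dim_col B = m" "dim_row D = m"
    "dim_col D = m" "dim_row X = l" "dim_col X = m"
    using A B D X by auto
  have c [simp]: "X * D \<in> carrier_mat l m" "A * X \<in> carrier_mat l m" "- X \<in> carrier_mat l m"
    using A D X by auto
  have o: "1\<^sub>m l \<in> carrier_mat l l" "1\<^sub>m m \<in> carrier_mat m m" "0\<^sub>m m l \<in> carrier_mat m l" by auto
  have "?P * ?Q = four_block_mat (1\<^sub>m l) (0\<^sub>m l m) (0\<^sub>m m l) (1\<^sub>m m)"
    unfolding mult_four_block_mat[OF o(1) X o(3,2) o(1) c(3) o(3,2)]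
    by (rule cong_four_block_mat) (use X in auto)
  moreover have "?Q * ?P = four_block_mat (1\<^sub>m l) (0\<^sub>m l m) (0\<^sub>m m l) (1\<^sub>m m)"
    unfolding mult_four_block_mat[OF o(1) c(3) o(3,2) o(1) X o(3,2)]
    by (rule cong_four_block_mat) (use X in auto)
  ultimately have PQ: "?P * ?Q = 1\<^sub>m (l + m)" "?Q * ?P = 1\<^sub>m (l + m)"
    unfolding four_block_one_mat by blast+
  have bc: "B + (A * X - X * D) \<in> carrier_mat l m"
    using B by auto
  have "?P * ?N = four_block_mat A (B + A * X) (0\<^sub>m m l) D"
    unfolding mult_four_block_mat[OF o(1) X o(3,2) A bc o(3) D]
  proof (rule cong_four_block_mat)
    have "1\<^sub>m l * (B + (A * X - X * D)) = B + (A * X - X * D)"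
      by (rule left_mult_one_mat[OF bc])
    then show "1\<^sub>m l * (B + (A * X - X * D)) + X * D = B + A * X"
      using B c(1,2) by (intro eq_matI) (simp_all del: index_mult_mat(1))
  qed (use A D X bc in \<open>auto simp: left_mult_one_mat[OF bc]\<close>)
  also have "\<dots> = ?M * ?P"
    unfolding mult_four_block_mat[OF A B o(3) D o(1) X o(3,2)]
  proof (rule cong_four_block_mat)
    show "B + A * X = A * X + B * 1\<^sub>m m"
      using B c(1,2) by (simp add: comm_add_mat[OF B c(2)])
  qed (use A B D X in auto)
  finally have PN: "?P * ?N = ?M * ?P" .
  have cc: "?M \<in> carrier_mat (l+m) (l+m)" "?N \<in> carrier_mat (l+m) (l+m)"
     "?P \<in> carrier_mat (l+m) (l+m)" "?Q \<in> carrier_mat (l+m) (l+m)"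
    using A B D X by auto
  have "?P * ?N * ?Q = ?M * (?P * ?Q)"
    unfolding PN using cc by (intro assoc_mult_mat) auto
  then have "?M = ?P * ?N * ?Q" unfolding PQ(1) right_mult_one_mat[OF cc(1)] by (rule sym)
  then have "similar_mat_wit ?M ?N ?P ?Q"
    by (rule similar_mat_witI[OF PQ _ cc])
  then show ?thesis
    by (rule similar_fixing_lastI)
      (rule last_row_unit_four_block[of _ m _ l], use m in \<open>auto simp: last_row_unit_one\<close>)+
qed

lemma three_segments:
  fixes p a d k :: nat
  assumes "p < a + d + k"
  obtains "p < a" | p' where "p = a + p'" "p' < d" | p' where "p = a + (d + p')" "p' < k"
  using assms that(1) that(2)[of "p - a"] that(3)[of "p - a - d"] by linarith

text \<open>
  Once the tail has been split as \<open>D \<oplus> K\<close>, with the last basis vector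
  inside \<open>K\<close>, the border of \<open>A\<close> only meets \<open>K\<close>; moving
  \<open>D\<close> to the front separates it from the interaction.
\<close>

lemma similar_fixing_last_swap:
  fixes A :: "'a :: semiring_1 mat"
  assumes A: "A \<in> carrier_mat a a" and D: "D \<in> carrier_mat d d" and K: "K \<in> carrier_mat k k"
    and k: "0 < k"
  shows "similar_fixing_last
     (four_block_mat A (lastcol a (d + k) c) (0\<^sub>m (d + k) a) (four_block_mat D (0\<^sub>m d k) (0\<^sub>m k d) K))
     (four_block_mat D (0\<^sub>m d (a + k)) (0\<^sub>m (a + k) d) (four_block_mat A (lastcol a k c) (0\<^sub>m k a) K))"
    (is "similar_fixing_last ?L ?R")
proof -
  let ?n = "a + d + k"
  define f where "f i = (if i < a then i + d else if i < a + d then i - a else i)" for i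
  define g where "g i = (if i < d then i + a else if i < a + d then i - d else i)" for i
  have R: "?R \<in> carrier_mat ?n ?n" using A D K by (auto simp: add.assoc add.left_commute)
  have [simp]: "dim_row A = a" "dim_col A = a" "dim_row D = d" "dim_col D = d"
    "dim_row K = k" "dim_col K = k"
    using A D K by auto
  have "?L = mat ?n ?n (\<lambda>(i, j). ?R $$ (f i, f j))"
  proof (rule eq_matI)
    fix i j assume "i < dim_row (mat ?n ?n (\<lambda>(i, j). ?R $$ (f i, f j)))"
      "j < dim_col (mat ?n ?n (\<lambda>(i, j). ?R $$ (f i, f j)))"
    then have ij: "i < ?n" "j < ?n" by auto
    have f: "\<And>p. p < a \<Longrightarrow> f p = d + p" "\<And>p. p < d \<Longrightarrow> f (a + p) = p"
      "\<And>p. f (a + (d + p)) = d + (a + p)"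
      by (auto simp: f_def)
    show "?L $$ (i, j) = mat ?n ?n (\<lambda>(i, j). ?R $$ (f i, f j)) $$ (i, j)"
      by (rule three_segments[OF ij(1)]; rule three_segments[OF ij(2)]; use ij k in \<open>simp add: f\<close>)
  qed auto
  moreover have "similar_fixing_last (mat ?n ?n (\<lambda>(i, j). ?R $$ (f i, f j))) ?R"
  proof (rule similar_fixing_lastI[OF similar_mat_permute[OF R, of f g]])
    have last: "f (?n - 1) = ?n - 1" and inj: "\<And>j. j < ?n \<Longrightarrow> f j = ?n - 1 \<longleftrightarrow> j = ?n - 1"
      using k by (auto simp: f_def)
    show "last_row_unit (mat ?n ?n (\<lambda>(i, j). if j = f i then 1 else 0 :: 'a))"
      unfolding last_row_unit_def using k last by auto
    show "last_row_unit (mat ?n ?n (\<lambda>(i, j). if i = f j then 1 else 0 :: 'a))"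
      unfolding last_row_unit_def
    proof (intro allI impI)
      fix j assume "j < dim_col (mat ?n ?n (\<lambda>(i, j). if i = f j then 1 else 0 :: 'a))"
      then have j: "j < ?n" by simp
      have "?n - 1 < ?n" using k by simp
      then show "mat ?n ?n (\<lambda>(i, j). if i = f j then 1 else 0 :: 'a) $$
          (dim_row (mat ?n ?n (\<lambda>(i, j). if i = f j then 1 else 0 :: 'a)) - 1, j) =
        (if Suc j = dim_col (mat ?n ?n (\<lambda>(i, j). if i = f j then 1 else 0 :: 'a)) then 1 else 0)"
        using j inj[OF j] by auto
    qed
  qed (auto simp: f_def g_def)
  ultimately show ?thesis by (rule subst[OF sym])
qed

lemma similar_mat_swap_blocks:
  fixes A :: "'a :: semiring_1 mat"
  assumes A: "A \<in> carrier_mat a a" and D: "D \<in> carrier_mat d d"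
  shows "similar_mat (four_block_mat A (0\<^sub>m a d) (0\<^sub>m d a) D) (four_block_mat D (0\<^sub>m d a) (0\<^sub>m a d) A)"
    (is "similar_mat ?L ?R")
proof -
  let ?n = "a + d"
  define f where "f i = (if i < a then i + d else i - a)" for i
  define g where "g i = (if i < d then i + a else i - d)" for i
  have R: "?R \<in> carrier_mat ?n ?n" using A D by (auto simp: add.commute)
  have "?L = mat ?n ?n (\<lambda>(i, j). ?R $$ (f i, f j))"
    by (rule eq_matI) (use A D in \<open>auto simp: f_def\<close>)
  moreover have "similar_mat (mat ?n ?n (\<lambda>(i, j). ?R $$ (f i, f j))) ?R"
    unfolding similar_mat_def
    by (intro exI, rule similar_mat_permute[OF R, of f g]) (auto simp: f_def g_def)
  ultimately show ?thesis by (rule subst[OF sym])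
qed

section \<open>Reordering Jordan blocks\<close>

lemma jordan_matrix_append:
  "jordan_matrix (xs @ ys) = four_block_mat (jordan_matrix xs)
     (0\<^sub>m (sum_list (map fst xs)) (sum_list (map fst ys)))
     (0\<^sub>m (sum_list (map fst ys)) (sum_list (map fst xs))) (jordan_matrix ys)"
  unfolding jordan_matrix_def map_append diag_block_mat_append Let_def
  by (simp add: jordan_matrix_def[symmetric])

lemma jordan_matrix_rotate: 
  fixes xs :: "(nat \<times> 'a :: semiring_1) list"
  shows "similar_mat (jordan_matrix (xs @ ys)) (jordan_matrix (ys @ xs))"
  unfolding jordan_matrix_append by (rule similar_mat_swap_blocks) auto

lemma jordan_matrix_mset:
  fixes xs :: "(nat \<times> 'a :: semiring_1) list"
  assumes "mset xs = mset ys"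
  shows "similar_mat (jordan_matrix xs) (jordan_matrix ys)"
  using assms
proof (induction xs arbitrary: ys)
  case Nil
  then show ?case by (auto intro!: similar_mat_refl[of _ 0] simp: carrier_matI)
next
  case (Cons x xs)
  have "x \<in> set ys" using Cons.prems by (metis list.set_intros(1) set_mset_mset)
  then obtain us vs where ys: "ys = us @ x # vs" by (meson split_list)
  have "mset xs = mset (vs @ us)" using Cons.prems ys by simp
  from Cons.IH[OF this] have "similar_mat (jordan_matrix ([x] @ xs)) (jordan_matrix ([x] @ (vs @ us)))"
    unfolding jordan_matrix_append[of "[x]"]
  proof -
    assume sim: "similar_mat (jordan_matrix xs) (jordan_matrix (vs @ us))"
    have e: "sum_list (map fst (vs @ us)) = sum_list (map fst xs)"
      using similar_matD[OF sim] by (metis carrier_matD(1) insert_subset jordan_matrix_dim(1))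
    show "similar_mat
     (four_block_mat (jordan_matrix [x]) (0\<^sub>m (sum_list (map fst [x])) (sum_list (map fst xs)))
       (0\<^sub>m (sum_list (map fst xs)) (sum_list (map fst [x]))) (jordan_matrix xs))
     (four_block_mat (jordan_matrix [x]) (0\<^sub>m (sum_list (map fst [x])) (sum_list (map fst (vs @ us))))
       (0\<^sub>m (sum_list (map fst (vs @ us))) (sum_list (map fst [x]))) (jordan_matrix (vs @ us)))"
      unfolding e
      by (rule similar_mat_four_block_0_0[OF similar_mat_refl sim])
       (rule jordan_matrix_carrier)+
  qed
  also have "[x] @ (vs @ us) = (x # vs) @ us" by simp
  also note similar = jordan_matrix_rotate[of "x # vs" us]
  finally (similar_mat_trans) show ?case using ys by simp
qed

section \<open>Sylvester equations for triangular matrices\<close>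

text \<open>
  Back substitution. The relation \<open>R i\<close> says which residues are acceptable in row
  \<open>i\<close>; it is \<open>= 0\<close> when the equation is to be solved exactly, and
  \<open>commutes with z\<close> when only the part of the residue that the scalar equation
  can reach is to be removed.
\<close>

lemma upper_triangular_solve:
  fixes T :: "nat \<Rightarrow> nat \<Rightarrow> 'a :: ring"
  assumes diag: "\<And>i q. i < n \<Longrightarrow> \<exists>s. R i (q + (T i i * s - s * z))"
  shows "\<exists>s. \<forall>i<n. R i (c i + ((\<Sum>j\<in>{i..<n}. T i j * s j) - s i * z))"
proof -
  have "\<exists>s. \<forall>i. n - m \<le> i \<and> i < n \<longrightarrow> R i (c i + ((\<Sum>j\<in>{i..<n}. T i j * s j) - s i * z))"
    if "m \<le> n" for m
    using that
  proof (induction m)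
    case 0
    then show ?case by auto
  next
    case (Suc m)
    then obtain s where s: "\<And>i. n - m \<le> i \<Longrightarrow> i < n \<Longrightarrow>
        R i (c i + ((\<Sum>j\<in>{i..<n}. T i j * s j) - s i * z))"
      by auto
    define r where "r = n - Suc m"
    have r: "r < n" "n - m = Suc r" using Suc.prems by (auto simp: r_def)
    obtain t where t: "R r (c r + (\<Sum>j\<in>{Suc r..<n}. T r j * s j) + (T r r * t - t * z))"
      using diag[OF r(1)] by blast
    have "R i (c i + ((\<Sum>j\<in>{i..<n}. T i j * (s(r := t)) j) - (s(r := t)) i * z))"
      if "r \<le> i" "i < n" for i
    proof (cases "i = r")
      case True
      have "(\<Sum>j\<in>{Suc r..<n}. T r j * (s(r := t)) j) = (\<Sum>j\<in>{Suc r..<n}. T r j * s j)"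
        by (rule sum.cong) auto
      then have "(\<Sum>j\<in>{r..<n}. T r j * (s(r := t)) j) = T r r * t + (\<Sum>j\<in>{Suc r..<n}. T r j * s j)"
        using r by (subst sum.atLeast_Suc_lessThan) auto
      then show ?thesis using t True by (simp add: algebra_simps)
    next
      case False
      then have "r < i" using that by simp
      then have "(\<Sum>j\<in>{i..<n}. T i j * (s(r := t)) j) = (\<Sum>j\<in>{i..<n}. T i j * s j)"
        by (intro sum.cong) auto
      then show ?thesis using s[of i] \<open>r < i\<close> that r by simp
    qed
    then show ?case unfolding r_def[symmetric] by blast
  qed
  from this[of n] show ?thesis by auto
qed

lemma jordan_block_row_sum:
  fixes a :: "'a :: semiring_1"
  assumes "i < n"
  shows "(\<Sum>j\<in>{i..<n}. jordan_block n a $$ (i, j) * s j)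
    = a * s i + (if Suc i < n then s (Suc i) else 0)"
proof (cases "Suc i < n")
  case True
  have "(\<Sum>j\<in>{Suc (Suc i)..<n}. jordan_block n a $$ (i, j) * s j) = 0"
    using assms by (intro sum.neutral) auto
  then show ?thesis
    using assms True by (simp add: sum.atLeast_Suc_lessThan)
next
  case False
  then have "{i..<n} = {i}" using assms by auto
  then show ?thesis using assms False by simp
qed

lemma jordan_block_mult_left:
  fixes X :: "'a :: semiring_1 mat"
  assumes X: "X \<in> carrier_mat l k" and "i < l" "j < k"
  shows "(jordan_block l w * X) $$ (i, j) = w * X $$ (i, j) + (if Suc i < l then X $$ (Suc i, j) else 0)"
proof -
  have "(jordan_block l w * X) $$ (i, j) = (\<Sum>r\<in>{0..<l}. jordan_block l w $$ (i, r) * X $$ (r, j))"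
    using assms by (auto simp: scalar_prod_def)
  also have "\<dots> = (\<Sum>r\<in>{i..<l}. jordan_block l w $$ (i, r) * X $$ (r, j))"
    by (rule sum.mono_neutral_right) (use assms in auto)
  finally show ?thesis unfolding jordan_block_row_sum[OF \<open>i < l\<close>] .
qed

lemma jordan_block_mult_right:
  fixes X :: "'a :: semiring_1 mat"
  assumes X: "X \<in> carrier_mat l k" and "i < l" "j < k"
  shows "(X * jordan_block k z) $$ (i, j) = X $$ (i, j) * z + (if 0 < j then X $$ (i, j - 1) else 0)"
proof -
  have "(X * jordan_block k z) $$ (i, j) = (\<Sum>r\<in>{0..<k}. X $$ (i, r) * jordan_block k z $$ (r, j))"
    using assms by (auto simp: scalar_prod_def)
  also have "\<dots> = (\<Sum>r\<in>{0..<k}. (if r = j then X $$ (i, j) * z else 0) + (if Suc r = j then X $$ (i, r) else 0))"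
    by (rule sum.cong) (use assms in auto)
  also have "\<dots> = X $$ (i, j) * z + (\<Sum>r\<in>{0..<k}. if Suc r = j then X $$ (i, r) else 0)"
    using assms by (simp add: sum.distrib)
  also have "(\<Sum>r\<in>{0..<k}. if Suc r = j then X $$ (i, r) else 0)
      = (\<Sum>r\<in>{0..<k}. if r = j - 1 then (if 0 < j then X $$ (i, j - 1) else 0) else 0)"
    by (rule sum.cong) auto
  finally show ?thesis using assms by auto
qed

section \<open>Two Jordan blocks joined by a last column\<close>

text \<open>
  A shear by a matrix supported in the last column keeps the border in the last column.
\<close>

lemma shear_lastcol:
  fixes w z :: "'a :: ring_1"
  assumes k: "0 < k"
  shows "similar_fixing_last
    (four_block_mat (jordan_block l w) (lastcol l k c) (0\<^sub>m k l) (jordan_block k z))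
    (four_block_mat (jordan_block l w)
      (lastcol l k (\<lambda>i. c i + (w * d i + (if Suc i < l then d (Suc i) else 0) - d i * z)))
      (0\<^sub>m k l) (jordan_block k z))"
proof -
  let ?X = "lastcol l k d"
  have "lastcol l k c + (jordan_block l w * ?X - ?X * jordan_block k z)
    = lastcol l k (\<lambda>i. c i + (w * d i + (if Suc i < l then d (Suc i) else 0) - d i * z))"
    by (rule eq_matI)
      (auto simp: jordan_block_mult_left[of _ l k] jordan_block_mult_right[of _ l k]
        simp del: index_mult_mat(1))
  moreover have "similar_fixing_last
    (four_block_mat (jordan_block l w) (lastcol l k c) (0\<^sub>m k l) (jordan_block k z))
    (four_block_mat (jordan_block l w)
      (lastcol l k c + (jordan_block l w * ?X - ?X * jordan_block k z)) (0\<^sub>m k l) (jordan_block k z))"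
    by (rule similar_fixing_last_shear) (use k in auto)
  ultimately show ?thesis by simp
qed

text \<open>
  In terms of chains: let $v$ be the head of a chain of length $k$, let $v'$ be the vector
  below it, and suppose that $A v - v z = v' + u a$, where $u$ is the head of a chain of
  length $l < k$. Replacing $v'$ by $v' + u a$, and the vectors further down by the images of
  this one under $x \mapsto A x - x z$, removes the extra term; the longer chain has room for
  all these corrections because $l < k$. As $a$ commutes with $z$, this map acts on the
  multiples $x a$ as it acts on $x$.
\<close>

lemma border_remove:
  fixes z a :: "'a :: ring_1"
  assumes lk: "l < k" and comm: "a * z = z * a"
  shows "similar_fixing_last
    (four_block_mat (jordan_block l z) (lastcol l k (\<lambda>i. if Suc i = l then a else 0)) (0\<^sub>m k l) (jordan_block k z))
    (four_block_mat (jordan_block l z) (0\<^sub>m l k) (0\<^sub>m k l) (jordan_block k z))"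
proof -
  \<comment> \<open>column \<open>k - 2\<close> repeats the border; going left, each column is shifted up by one row\<close>
  let ?X = "mat l k (\<lambda>(i, j). if i + k = j + l + 1 then a else 0)"
  let ?c = "lastcol l k (\<lambda>i. if Suc i = l then a else 0)"
  have "?c + (jordan_block l z * ?X - ?X * jordan_block k z) = 0\<^sub>m l k"
    by (rule eq_matI)
      (use lk in \<open>auto simp: comm jordan_block_mult_left[of _ l k] jordan_block_mult_right[of _ l k]
        simp del: index_mult_mat(1)\<close>)
  moreover have "similar_fixing_last
    (four_block_mat (jordan_block l z) ?c (0\<^sub>m k l) (jordan_block k z))
    (four_block_mat (jordan_block l z)
      (?c + (jordan_block l z * ?X - ?X * jordan_block k z)) (0\<^sub>m k l) (jordan_block k z))"
    by (rule similar_fixing_last_shear) (use lk in auto)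
  ultimately show ?thesis by simp
qed

text \<open>
  If the bordering vector is mapped onto a nonzero multiple of the head of a chain, it
  prolongs that chain. Multiplying the chain by the coefficient \<open>a\<close> normalises
  the new entry to \<open>1\<close>, and leaves the block unchanged because \<open>a\<close>
  commutes with \<open>z\<close>.
\<close>

lemma border_extend:
  fixes z a :: "'a :: division_ring"
  assumes l: "0 < l" and comm: "a * z = z * a" and a: "a \<noteq> 0"
  shows "similar_fixing_last
    (four_block_mat (jordan_block l z) (lastcol l 1 (\<lambda>i. if Suc i = l then a else 0)) (0\<^sub>m 1 l) (jordan_block 1 z))
    (jordan_block (Suc l) z)"
proof -
  let ?J = "jordan_block l z" and ?D = "jordan_block 1 z"
  let ?e = "\<lambda>a. lastcol l 1 (\<lambda>i. if Suc i = l then a else 0)"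
  let ?P = "mat l l (\<lambda>(i, j). if i = j then a else 0)"
  let ?Q = "mat l l (\<lambda>(i, j). if i = j then inverse a else 0)"
  have left: "mat l l (\<lambda>(i, j). if i = j then b else 0) * X = mat l r (\<lambda>(i, j). b * X $$ (i, j))"
    if "X \<in> carrier_mat l r" for b and X :: "'a mat" and r
    by (rule eq_matI) (use that in \<open>auto simp: scalar_prod_def if_distrib[of "\<lambda>x. x * _"] cong: if_cong\<close>)
  have right: "X * mat l l (\<lambda>(i, j). if i = j then b else 0) = mat r l (\<lambda>(i, j). X $$ (i, j) * b)"
    if "X \<in> carrier_mat r l" for b and X :: "'a mat" and r
    by (rule eq_matI) (use that in \<open>auto simp: scalar_prod_def if_distrib[of "\<lambda>x. _ * x"] cong: if_cong\<close>)
  have PQ: "?P * ?Q = 1\<^sub>m l" "?Q * ?P = 1\<^sub>m l"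
    by (rule eq_matI; use a in \<open>auto simp: left[of _ l]\<close>)+
  have JP: "?P * ?J = ?J * ?P"
    by (rule eq_matI) (use comm in \<open>auto simp: left[of _ l] right[of _ l]\<close>)
  have "?P * ?J * ?Q = ?J * (?P * ?Q)"
    unfolding JP by (rule assoc_mult_mat[of _ l l _ l _ l]) auto
  then have wit: "similar_mat_wit ?J ?J ?P ?Q"
    using PQ by (intro similar_mat_witI[OF PQ]) auto
  have "?e a = ?P * ?e 1 * 1\<^sub>m 1"
    by (subst right_mult_one_mat[of _ l 1]; (rule eq_matI)?; auto simp: left[of _ 1])
  then have "similar_mat_wit (four_block_mat ?J (?e a) (0\<^sub>m 1 l) ?D) (four_block_mat ?J (?e 1) (0\<^sub>m 1 l) ?D)
     (four_block_mat ?P (0\<^sub>m l 1) (0\<^sub>m 1 l) (1\<^sub>m 1)) (four_block_mat ?Q (0\<^sub>m l 1) (0\<^sub>m 1 l) (1\<^sub>m 1))"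
    by (intro similar_mat_wit_four_block[OF wit similar_mat_wit_refl]) auto
  moreover have "four_block_mat ?J (?e 1) (0\<^sub>m 1 l) ?D = jordan_block (Suc l) z"
    by (rule eq_matI) (auto simp: less_Suc_eq)
  ultimately have "similar_mat_wit (four_block_mat ?J (?e a) (0\<^sub>m 1 l) ?D) (jordan_block (Suc l) z)
     (four_block_mat ?P (0\<^sub>m l 1) (0\<^sub>m 1 l) (1\<^sub>m 1)) (four_block_mat ?Q (0\<^sub>m l 1) (0\<^sub>m 1 l) (1\<^sub>m 1))"
    by simp
  then show ?thesis
    by (rule similar_fixing_lastI)
      (rule last_row_unit_four_block[of _ 1 _ l]; simp add: last_row_unit_one)+
qed

section \<open>Quaternions as pairs of complex numbers\<close>

text \<open>
  The quaternion $a + b j$. In these coordinates $j z = \bar z j$ turns equations over the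
  quaternions into pairs of complex ones.
\<close>

definition quat_pair :: "complex \<Rightarrow> complex \<Rightarrow> quat" where
  "quat_pair a b = Quat (Re a) (Im a) (Re b) (Im b)"

lemma quat_pair_cases: obtains a b where "q = quat_pair a b"
  by (cases q) (metis complex.sel quat_pair_def)

lemma quat_pair_inject [simp]: "quat_pair a b = quat_pair c d \<longleftrightarrow> a = c \<and> b = d"
  by (auto simp: quat_pair_def complex_eq_iff)

lemma quat_pair_mult [simp]:
  "quat_pair a b * quat_pair c d = quat_pair (a * c - b * cnj d) (a * d + b * cnj c)"
  by (simp add: quat_pair_def times_quat_def algebra_simps)

lemma quat_pair_add [simp]: "quat_pair a b + quat_pair c d = quat_pair (a + c) (b + d)"
  and quat_pair_diff [simp]: "quat_pair a b - quat_pair c d = quat_pair (a - c) (b - d)"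
  by (simp_all add: quat_pair_def quat_defs)

lemma quat_of_complex_eq_pair: "quat_of_complex z = quat_pair z 0"
  and zero_quat_eq_pair: "0 = quat_pair 0 0"
  by (simp_all add: quat_pair_def quat_of_complex_def quat_defs)

lemma sum_quat_pair: "(\<Sum>i\<in>S. quat_pair (f i) (g i)) = quat_pair (sum f S) (sum g S)"
  by (induction S rule: infinite_finite_induct) (auto simp: zero_quat_eq_pair)

lemma quat_of_complex_commute_real:
  assumes "Im z = 0" shows "q * quat_of_complex z = quat_of_complex z * q"
proof -
  have "cnj z = z" using assms by (simp add: complex_eq_iff)
  then show ?thesis
    by (cases q rule: quat_pair_cases) (simp add: quat_of_complex_eq_pair mult.commute)
qed

text \<open>
  Writing $q = a + b j$ and $s = \sigma + \tau j$, the operator $s \mapsto w s - s z$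
  multiplies $\sigma$ by $w - z$ and $\tau$ by $w - \bar z$. For distinct $w$, $z$ in the
  closed upper half plane both factors are nonzero.
\<close>

lemma quat_sylvester_distinct:
  assumes "0 \<le> Im w" "0 \<le> Im z" "w \<noteq> z"
  shows "\<exists>s. q + (quat_of_complex w * s - s * quat_of_complex z) = 0"
proof -
  obtain a b where q: "q = quat_pair a b" by (rule quat_pair_cases)
  have ne: "w \<noteq> cnj z" using assms by (auto simp: complex_eq_iff)
  have solve: "c + (w * (- c / (w - y)) - (- c / (w - y)) * y) = 0" if "w \<noteq> y" for c y
  proof -
    have "w * (- c / (w - y)) - (- c / (w - y)) * y = (- c / (w - y)) * (w - y)"
      by (simp only: right_diff_distrib mult.commute[of w])
    then show ?thesis using that by simp
  qed
  show ?thesis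
    by (intro exI[of _ "quat_pair (- a / (w - z)) (- b / (w - cnj z))"])
      (simp only: q quat_of_complex_eq_pair zero_quat_eq_pair quat_pair_mult quat_pair_add
        quat_pair_diff quat_pair_inject complex_cnj_zero mult_zero_left mult_zero_right
        diff_0_right add_0_right add_0_left solve[OF \<open>w \<noteq> z\<close>] solve[OF ne] simp_thms)
qed

text \<open>
  For \<open>w = z\<close> the first factor vanishes, so that only the $j$-part of
  \<open>q\<close> can be removed; what is left is complex, hence commutes with
  \<open>z\<close>. For real \<open>z\<close> nothing can be removed, but everything commutes.
\<close>

lemma quat_sylvester_same:
  "\<exists>s. (q + (quat_of_complex z * s - s * quat_of_complex z)) * quat_of_complex z
     = quat_of_complex z * (q + (quat_of_complex z * s - s * quat_of_complex z))"
proof (cases "Im z = 0")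
  case True
  then show ?thesis using quat_of_complex_commute_real by blast
next
  case False
  obtain a b where q: "q = quat_pair a b" by (rule quat_pair_cases)
  have "z - cnj z \<noteq> 0" using False by (auto simp: complex_eq_iff)
  then have "b + (z * (- b / (z - cnj z)) + b / (z - cnj z) * cnj z) = 0"
    by (simp add: divide_simps) (simp add: algebra_simps)
  then show ?thesis
    by (intro exI[of _ "quat_pair 0 (- b / (z - cnj z))"])
      (simp add: q quat_of_complex_eq_pair algebra_simps)
qed

section \<open>Adding one vector to a quaternionic Jordan basis\<close>

definition quat_jordan_matrix :: "(nat \<times> complex) list \<Rightarrow> quat mat" where
  "quat_jordan_matrix bs = jordan_matrix (map (\<lambda>(k, z). (k, quat_of_complex z)) bs)"

lemma sum_list_map_blocks [simp]:
  "sum_list (map (fst \<circ> (\<lambda>(k, z). (k, f z))) bs) = sum_list (map fst bs)"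
  by (induction bs) auto

lemma quat_jordan_matrix_carrier [simp]:
  "quat_jordan_matrix bs \<in> carrier_mat (sum_list (map fst bs)) (sum_list (map fst bs))"
  using jordan_matrix_carrier[of "map (\<lambda>(k, z). (k, quat_of_complex z)) bs"]
  by (simp add: quat_jordan_matrix_def)

lemma quat_jordan_matrix_dim [simp]:
  "dim_row (quat_jordan_matrix bs) = sum_list (map fst bs)"
  "dim_col (quat_jordan_matrix bs) = sum_list (map fst bs)"
  using quat_jordan_matrix_carrier[of bs] unfolding carrier_mat_def by blast+

lemma quat_jordan_matrix_append:
  "quat_jordan_matrix (xs @ ys) = four_block_mat (quat_jordan_matrix xs)
     (0\<^sub>m (sum_list (map fst xs)) (sum_list (map fst ys)))
     (0\<^sub>m (sum_list (map fst ys)) (sum_list (map fst xs))) (quat_jordan_matrix ys)"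
  by (simp add: quat_jordan_matrix_def jordan_matrix_append)

lemma quat_jordan_matrix_Nil [simp]: "quat_jordan_matrix [] = 0\<^sub>m 0 0"
  by (simp add: quat_jordan_matrix_def jordan_matrix_def)

lemma quat_jordan_matrix_single [simp]: "quat_jordan_matrix [(k, z)] = jordan_block k (quat_of_complex z)"
  by (simp add: quat_jordan_matrix_def jordan_matrix_def del: diag_block_mat.simps)

lemma quat_jordan_matrix_Cons:
  "quat_jordan_matrix ((k, z) # bs) = four_block_mat (jordan_block k (quat_of_complex z))
     (0\<^sub>m k (sum_list (map fst bs))) (0\<^sub>m (sum_list (map fst bs)) k) (quat_jordan_matrix bs)"
  using quat_jordan_matrix_append[of "[(k, z)]" bs] by simp

text \<open>
  The border of a single block reduces to one coefficient at the head of the chain. A first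
  shear makes all coefficients commute with \<open>z\<close>, or vanish when the eigenvalues
  differ. The second shear uses coefficients that commute with \<open>z\<close> themselves:
  for them $x \mapsto A x - x z$ is just the shift along the chain, which reaches every
  position except the head.
\<close>

lemma border_reduce:
  assumes wz: "0 \<le> Im w" "0 \<le> Im z" and l: "0 < l" and k: "0 < k"
  defines "W \<equiv> quat_of_complex w" and "Z \<equiv> quat_of_complex z"
  obtains a where "a * Z = Z * a" "w \<noteq> z \<Longrightarrow> a = 0"
    "similar_fixing_last
      (four_block_mat (jordan_block l W) (lastcol l k c) (0\<^sub>m k l) (jordan_block k Z))
      (four_block_mat (jordan_block l W) (lastcol l k (\<lambda>i. if Suc i = l then a else 0))
         (0\<^sub>m k l) (jordan_block k Z))"
proof -
  define R where "R i q \<longleftrightarrow> q * Z = Z * q \<and> (w \<noteq> z \<longrightarrow> q = 0)" for i :: nat and q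
  have "\<exists>s. \<forall>i<l. R i (c i + ((\<Sum>j\<in>{i..<l}. jordan_block l W $$ (i, j) * s j) - s i * Z))"
  proof (rule upper_triangular_solve)
    fix i q assume "i < l"
    show "\<exists>s. R i (q + (jordan_block l W $$ (i, i) * s - s * Z))"
    proof (cases "w = z")
      case True
      then show ?thesis
        using quat_sylvester_same[of q z] \<open>i < l\<close> by (simp add: R_def W_def Z_def)
    next
      case False
      from quat_sylvester_distinct[OF wz False, of q]
      obtain s where "q + (W * s - s * Z) = 0" by (auto simp: W_def Z_def)
      then show ?thesis
        using \<open>i < l\<close> by (intro exI[of _ s]) (simp add: R_def)
    qed
  qed
  then obtain s where
    s0: "\<forall>i<l. R i (c i + ((\<Sum>j\<in>{i..<l}. jordan_block l W $$ (i, j) * s j) - s i * Z))"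
    by blast
  have s: "R i (c i + (W * s i + (if Suc i < l then s (Suc i) else 0) - s i * Z))" if "i < l" for i
    using s0[rule_format, OF that] unfolding jordan_block_row_sum[OF that] .
  define p where "p i = (if i < l then c i + (W * s i + (if Suc i < l then s (Suc i) else 0) - s i * Z) else 0)" for i
  \<comment> \<open>the second shear: the entry below position \<open>i\<close> cancels \<open>p i\<close>\<close>
  define d where "d i = (case i of 0 \<Rightarrow> 0 | Suc i' \<Rightarrow> - p i')" for i
  have p: "p i * Z = Z * p i" "w \<noteq> z \<Longrightarrow> p i = 0" for i
    using s[of i] by (auto simp: p_def R_def)
  have d: "W * d i - d i * Z = 0" for i
    using p by (cases "w = z") (auto simp: d_def W_def Z_def split: nat.split)
  have "similar_fixing_last
      (four_block_mat (jordan_block l W) (lastcol l k c) (0\<^sub>m k l) (jordan_block k Z))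
      (four_block_mat (jordan_block l W) (lastcol l k p) (0\<^sub>m k l) (jordan_block k Z))"
  proof -
    have "lastcol l k p = lastcol l k (\<lambda>i. c i + (W * s i + (if Suc i < l then s (Suc i) else 0) - s i * Z))"
      by (rule eq_matI) (auto simp: p_def)
    then show ?thesis using shear_lastcol[OF k] by simp
  qed
  also have "similar_fixing_last \<dots> (four_block_mat (jordan_block l W)
      (lastcol l k (\<lambda>i. if Suc i = l then p (l - 1) else 0)) (0\<^sub>m k l) (jordan_block k Z))"
  proof -
    have "p i + (W * d i + (if Suc i < l then d (Suc i) else 0) - d i * Z)
        = (if Suc i = l then p (l - 1) else 0)" if "i < l" for i
    proof -
      have "W * d i = d i * Z" using d[of i] by simp
      then show ?thesis using that by (cases "Suc i = l") (auto simp: d_def)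
    qed
    then have "lastcol l k (\<lambda>i. if Suc i = l then p (l - 1) else 0)
      = lastcol l k (\<lambda>i. p i + (W * d i + (if Suc i < l then d (Suc i) else 0) - d i * Z))"
      by (intro eq_matI) auto
    then show ?thesis using shear_lastcol[OF k] by simp
  qed
  finally show thesis using p by (intro that) auto
qed

text \<open>
  The block of the new vector has size \<open>k\<close>. The hypothesis on sizes leaves two
  situations in which the result is again a sum of Jordan blocks: the new vector has not
  joined any chain (\<open>k = 1\<close>) and may prolong this one, or it sits on a chain
  longer than this one, which then absorbs the border.
\<close>

lemma two_blocks:
  assumes wz: "0 \<le> Im w" "0 \<le> Im z" and l: "0 < l" and k: "0 < k" and lk: "k = 1 \<or> l < k"
  shows "\<exists>bs k'. 0 < k' \<and> (k' = k \<or> k' = Suc l) \<and> set bs \<subseteq> {(l, w)} \<and>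
    similar_fixing_last
      (four_block_mat (jordan_block l (quat_of_complex w)) (lastcol l k c) (0\<^sub>m k l)
         (jordan_block k (quat_of_complex z)))
      (quat_jordan_matrix (bs @ [(k', z)]))"
proof -
  let ?W = "quat_of_complex w" and ?Z = "quat_of_complex z"
  let ?M = "four_block_mat (jordan_block l ?W) (lastcol l k c) (0\<^sub>m k l) (jordan_block k ?Z)"
  obtain a where a: "a * ?Z = ?Z * a" "w \<noteq> z \<Longrightarrow> a = 0"
    and sim: "similar_fixing_last ?M
      (four_block_mat (jordan_block l ?W) (lastcol l k (\<lambda>i. if Suc i = l then a else 0))
         (0\<^sub>m k l) (jordan_block k ?Z))"
    using border_reduce[OF wz l k, of c] by blast
  have sum: "quat_jordan_matrix ([(l, w)] @ [(k, z)]) =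
     four_block_mat (jordan_block l ?W) (0\<^sub>m l k) (0\<^sub>m k l) (jordan_block k ?Z)"
    unfolding quat_jordan_matrix_append by simp
  consider "a = 0" | "a \<noteq> 0" "w = z" "l < k" | "a \<noteq> 0" "w = z" "k = 1" using a lk by blast
  then show ?thesis
  proof cases
    case 1
    have "lastcol l k (\<lambda>i. if Suc i = l then a else 0) = 0\<^sub>m l k"
      by (rule eq_matI) (auto simp: 1)
    then have "similar_fixing_last ?M (quat_jordan_matrix ([(l, w)] @ [(k, z)]))"
      using sim sum by simp
    then show ?thesis using k by (intro exI[of _ "[(l, w)]"] exI[of _ k]) auto
  next
    case 2
    have "similar_fixing_last ?M (quat_jordan_matrix ([(l, w)] @ [(k, z)]))"
      unfolding sum using similar_fixing_last_trans[OF sim] border_remove[OF 2(3) a(1)] 2(2) by blast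
    then show ?thesis using k by (intro exI[of _ "[(l, w)]"] exI[of _ k]) auto
  next
    case 3
    have "similar_fixing_last ?M (quat_jordan_matrix ([] @ [(Suc l, z)]))"
      using similar_fixing_last_trans[OF sim] border_extend[OF l a(1) 3(1)] 3(2,3) by auto
    then show ?thesis by (intro exI[of _ "[]"] exI[of _ "Suc l"]) auto
  qed
qed

lemma four_block_border_assoc:
  fixes A :: "'a :: zero mat"
  assumes A: "A \<in> carrier_mat a a" and D: "D \<in> carrier_mat d d" and K: "K \<in> carrier_mat k k"
    and k: "0 < k"
  shows "four_block_mat (four_block_mat A (0\<^sub>m a d) (0\<^sub>m d a) D) (lastcol (a + d) k c) (0\<^sub>m k (a + d)) K
    = four_block_mat A (lastcol a (d + k) c) (0\<^sub>m (d + k) a)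
        (four_block_mat D (lastcol d k (\<lambda>i. c (a + i))) (0\<^sub>m k d) K)" (is "?L = ?R")
proof (rule eq_matI)
  have [simp]: "dim_row A = a" "dim_col A = a" "dim_row D = d" "dim_col D = d"
    "dim_row K = k" "dim_col K = k"
    using A D K by auto
  fix i j assume "i < dim_row ?R" "j < dim_col ?R"
  then have ij: "i < a + d + k" "j < a + d + k" by auto
  show "?L $$ (i, j) = ?R $$ (i, j)"
    by (rule three_segments[OF ij(1)]; rule three_segments[OF ij(2)]; use ij k in simp)
qed (use A D K in auto)

lemma similar_mat_dim_row: "similar_mat A B \<Longrightarrow> dim_row A = dim_row B"
  using similar_matD by fastforce

text \<open>
  The blocks are treated one by one, the largest first (the list is sorted and the induction
  reaches its tail first). The first block whose border cannot be removed is prolonged by the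
  new vector, and by the ordering it is from then on longer than every block still to come, so
  that the borders of these can be removed. This is the maximal choice of a chain in the
  classical argument.
\<close>

lemma bordered_jordan:
  assumes "sorted (map fst bs)" "\<forall>(k, w) \<in> set bs. 0 < k \<and> 0 \<le> Im w" "0 \<le> Im z"
  shows "\<exists>bs' k. 0 < k \<and> (k = 1 \<or> k \<in> Suc ` fst ` set bs) \<and>
    (\<forall>(k, w) \<in> set bs'. 0 < k \<and> 0 \<le> Im w) \<and>
    similar_fixing_last
      (four_block_mat (quat_jordan_matrix bs) (lastcol (sum_list (map fst bs)) 1 c)
         (0\<^sub>m 1 (sum_list (map fst bs))) (jordan_block 1 (quat_of_complex z)))
      (quat_jordan_matrix (bs' @ [(k, z)]))"
  using assms(1,2)
proof (induction bs arbitrary: c)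
  case Nil
  have "four_block_mat (quat_jordan_matrix []) (lastcol 0 1 c) (0\<^sub>m 1 0) (jordan_block 1 (quat_of_complex z))
    = jordan_block 1 (quat_of_complex z)"
    by (rule eq_matI) auto
  then show ?case
    using similar_fixing_last_refl[OF jordan_block_carrier[of 1 "quat_of_complex z"]]
    by (intro exI[of _ "[]"] exI[of _ 1]) simp
next
  case (Cons b bs)
  obtain l w where b: "b = (l, w)" by force
  let ?N = "sum_list (map fst bs)"
  let ?W = "quat_of_complex w" and ?Z = "quat_of_complex z"
  have l: "0 < l" "0 \<le> Im w" using Cons.prems b by auto
  obtain bs' k where k: "0 < k" "k = 1 \<or> k \<in> Suc ` fst ` set bs"
    and bs': "\<forall>(k, w) \<in> set bs'. 0 < k \<and> 0 \<le> Im w"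
    and sim: "similar_fixing_last
      (four_block_mat (quat_jordan_matrix bs) (lastcol ?N 1 (\<lambda>i. c (l + i))) (0\<^sub>m 1 ?N) (jordan_block 1 ?Z))
      (quat_jordan_matrix (bs' @ [(k, z)]))"
    using Cons.IH[of "\<lambda>i. c (l + i)"] Cons.prems by auto
  let ?N' = "sum_list (map fst bs')"
  have N: "?N + 1 = ?N' + k"
    using similar_mat_dim_row[OF similar_fixing_last_imp_similar[OF sim]] by simp
  have lk: "k = 1 \<or> l < k"
    using k Cons.prems(1) b by auto
  obtain bs2 k2 where k2: "0 < k2" "k2 = k \<or> k2 = Suc l" "set bs2 \<subseteq> {(l, w)}"
    and sim2: "similar_fixing_last
      (four_block_mat (jordan_block l ?W) (lastcol l k c) (0\<^sub>m k l) (jordan_block k ?Z))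
      (quat_jordan_matrix (bs2 @ [(k2, z)]))"
    using two_blocks[OF l(2) assms(3) l(1) k(1) lk, of c] by blast
  have lk2: "sum_list (map fst (bs2 @ [(k2, z)])) = l + k"
    using similar_mat_dim_row[OF similar_fixing_last_imp_similar[OF sim2]] by simp
  let ?K = "four_block_mat (jordan_block l ?W) (lastcol l k c) (0\<^sub>m k l) (jordan_block k ?Z)"
  have "similar_fixing_last
      (four_block_mat (quat_jordan_matrix (b # bs)) (lastcol (l + ?N) 1 c) (0\<^sub>m 1 (l + ?N)) (jordan_block 1 ?Z))
      (four_block_mat (jordan_block l ?W) (lastcol l (?N + 1) c) (0\<^sub>m (?N + 1) l)
         (quat_jordan_matrix (bs' @ [(k, z)])))"
    unfolding b quat_jordan_matrix_Cons
    by (subst four_block_border_assoc[of _ l _ ?N _ 1])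
      (auto intro!: similar_fixing_last_four_block[OF _ _ _ sim[unfolded One_nat_def]]
         four_block_carrier_mat[of _ ?N ?N _ 1 1, simplified])
  also have "quat_jordan_matrix (bs' @ [(k, z)]) = four_block_mat (quat_jordan_matrix bs')
     (0\<^sub>m ?N' k) (0\<^sub>m k ?N') (jordan_block k ?Z)"
    by (simp add: quat_jordan_matrix_append)
  also have "similar_fixing_last (four_block_mat (jordan_block l ?W) (lastcol l (?N + 1) c) (0\<^sub>m (?N + 1) l) \<dots>)
     (four_block_mat (quat_jordan_matrix bs') (0\<^sub>m ?N' (l + k)) (0\<^sub>m (l + k) ?N') ?K)"
    unfolding N by (rule similar_fixing_last_swap) (use k in auto)
  also have "similar_fixing_last \<dots>
      (four_block_mat (quat_jordan_matrix bs') (0\<^sub>m ?N' (l + k)) (0\<^sub>m (l + k) ?N')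
        (quat_jordan_matrix (bs2 @ [(k2, z)])))"
  proof -
    have "lastcol ?N' (l + k) (\<lambda>_. 0) = (0\<^sub>m ?N' (l + k) :: quat mat)"
      by (rule eq_matI) auto
    moreover have "?K \<in> carrier_mat (l + k) (l + k)" by simp
    ultimately show ?thesis
      using similar_fixing_last_four_block[OF quat_jordan_matrix_carrier[of bs'] _ _ sim2, of "l + k" "\<lambda>_. 0"] k
      by simp
  qed
  also have "\<dots> = quat_jordan_matrix ((bs' @ bs2) @ [(k2, z)])"
    unfolding append_assoc quat_jordan_matrix_append[of bs'] lk2 ..
  finally have "similar_fixing_last
      (four_block_mat (quat_jordan_matrix (b # bs)) (lastcol (l + ?N) 1 c) (0\<^sub>m 1 (l + ?N)) (jordan_block 1 ?Z))
      (quat_jordan_matrix ((bs' @ bs2) @ [(k2, z)]))" .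
  moreover have "\<forall>(k, w) \<in> set (bs' @ bs2). 0 < k \<and> 0 \<le> Im w"
    using bs' k2(3) l by auto
  moreover have "k2 = 1 \<or> k2 \<in> Suc ` fst ` set (b # bs)"
    using k(2) k2(2) b by auto
  ultimately show ?case
    using k2(1) b by (intro exI[of _ "bs' @ bs2"] exI[of _ k2]) simp
qed

section \<open>Existence of the quaternionic Jordan form\<close>

text \<open>
  Write $A = B + C j$ and $y = p + q j$ with complex $B$, $C$, $p$, $q$. Then $y A = (p B - q
  \bar C) + (p C + q \bar B) j$, and left multiplication by a complex number acts
  componentwise; so $y A = \mu y$ is an ordinary eigenvalue problem for a complex matrix of
  twice the size. Replacing $y$ by $j y$ conjugates $\mu$, which brings it into the closed
  upper half plane.
\<close>

lemma left_eigenvector_exists: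
  assumes A: "A \<in> carrier_mat n n" and n: "0 < n"
  shows "\<exists>z y. 0 \<le> Im z \<and> (\<exists>i<n. y i \<noteq> 0) \<and>
    (\<forall>j<n. (\<Sum>i\<in>{0..<n}. y i * A $$ (i, j)) = quat_of_complex z * y j)"
proof -
  define B where "B i j = Complex (qre (A $$ (i, j))) (qim_i (A $$ (i, j)))" for i j
  define C where "C i j = Complex (qim_j (A $$ (i, j))) (qim_k (A $$ (i, j)))" for i j
  have BC: "A $$ (i, j) = quat_pair (B i j) (C i j)" for i j
    by (simp add: quat_pair_def B_def C_def)
  let ?G11 = "mat n n (\<lambda>(j, i). B i j)" and ?G12 = "mat n n (\<lambda>(j, i). - cnj (C i j))"
  let ?G21 = "mat n n (\<lambda>(j, i). C i j)" and ?G22 = "mat n n (\<lambda>(j, i). cnj (B i j))"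
  let ?G = "four_block_mat ?G11 ?G12 ?G21 ?G22"
  have G: "?G \<in> carrier_mat (n + n) (n + n)" by simp
  have "spectrum ?G \<noteq> {}" by (rule spectrum_non_empty[OF G]) (use n in simp)
  then obtain \<mu> v where v: "v \<in> carrier_vec (n + n)" "v \<noteq> 0\<^sub>v (n + n)" and ev: "?G *\<^sub>v v = \<mu> \<cdot>\<^sub>v v"
    unfolding spectrum_def eigenvalue_def eigenvector_def by auto
  define p where "p = vec_first v n"
  define q where "q = vec_last v n"
  have pq: "p \<in> carrier_vec n" "q \<in> carrier_vec n" "v = p @\<^sub>v q"
    using v(1) by (auto simp: p_def q_def)
  have "\<mu> \<cdot>\<^sub>v v = \<mu> \<cdot>\<^sub>v p @\<^sub>v \<mu> \<cdot>\<^sub>v q"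
    using pq by (auto intro!: eq_vecI)
  moreover have "?G *\<^sub>v v = (?G11 *\<^sub>v p + ?G12 *\<^sub>v q) @\<^sub>v (?G21 *\<^sub>v p + ?G22 *\<^sub>v q)"
    unfolding pq(3) by (rule four_block_mat_mult_vec) (use pq in auto)
  ultimately have eq: "?G11 *\<^sub>v p + ?G12 *\<^sub>v q = \<mu> \<cdot>\<^sub>v p" "?G21 *\<^sub>v p + ?G22 *\<^sub>v q = \<mu> \<cdot>\<^sub>v q"
    using ev pq append_vec_eq[of "?G11 *\<^sub>v p + ?G12 *\<^sub>v q" n "\<mu> \<cdot>\<^sub>v p"]
    by (metis (no_types, lifting) add_carrier_vec dim_row_mat(1) mult_mat_vec_carrier mat_carrier smult_carrier_vec)+
  have eq1: "(\<Sum>i\<in>{0..<n}. p $ i * B i j - q $ i * cnj (C i j)) = \<mu> * p $ j"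
    and eq2: "(\<Sum>i\<in>{0..<n}. p $ i * C i j + q $ i * cnj (B i j)) = \<mu> * q $ j" if "j < n" for j
    using arg_cong[OF eq(1), of "\<lambda>v. v $ j"] arg_cong[OF eq(2), of "\<lambda>v. v $ j"] that pq
    by (simp_all add: scalar_prod_def sum.distrib sum_subtractf sum_negf mult.commute)
  define y where "y i = quat_pair (p $ i) (q $ i)" for i
  have y: "(\<Sum>i\<in>{0..<n}. y i * A $$ (i, j)) = quat_of_complex \<mu> * y j" if "j < n" for j
    using eq1[OF that] eq2[OF that] by (simp add: y_def BC sum_quat_pair quat_of_complex_eq_pair)
  have y0: "\<exists>i<n. y i \<noteq> 0"
  proof (rule ccontr)
    assume "\<not> ?thesis"
    then have "p $ i = 0" "q $ i = 0" if "i < n" for i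
      using that by (auto simp: y_def zero_quat_eq_pair)
    then have "v = 0\<^sub>v (n + n)"
      using pq by (intro eq_vecI) auto
    then show False using v(2) by simp
  qed
  show ?thesis
  proof (cases "0 \<le> Im \<mu>")
    case True
    then show ?thesis using y y0 by blast
  next
    case False
    have comm: "quat_pair 0 1 * quat_of_complex \<mu> = quat_of_complex (cnj \<mu>) * quat_pair 0 1"
      by (simp add: quat_of_complex_eq_pair)
    have "(\<Sum>i\<in>{0..<n}. (quat_pair 0 1 * y i) * A $$ (i, j))
        = quat_of_complex (cnj \<mu>) * (quat_pair 0 1 * y j)" if "j < n" for j
      using arg_cong[OF y[OF that], of "\<lambda>x. quat_pair 0 1 * x"] comm
      by (simp add: sum_distrib_left mult.assoc[symmetric])
    moreover have "quat_pair 0 1 \<noteq> 0" by (simp add: zero_quat_eq_pair)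
    ultimately show ?thesis
      using y0 False by (intro exI[of _ "cnj \<mu>"] exI[of _ "\<lambda>i. quat_pair 0 1 * y i"]) auto
  qed
qed

text \<open>
  Taking the left eigenvector \<open>y\<close> as the last coordinate functional turns the
  last row of the matrix into a multiple of the last unit vector. The transition matrix
  \<open>?P\<close> is the identity with its last row replaced by \<open>y\<close>.
\<close>

lemma deflate_last:
  assumes A: "A \<in> carrier_mat (Suc m) (Suc m)" and ym: "y m \<noteq> 0"
    and y: "\<And>j. j < Suc m \<Longrightarrow> (\<Sum>i\<in>{0..<Suc m}. y i * A $$ (i, j)) = q * (y j :: quat)"
  shows "\<exists>A' c. A' \<in> carrier_mat m m \<and> c \<in> carrier_mat m 1 \<and>
    similar_mat A (four_block_mat A' c (0\<^sub>m 1 m) (jordan_block 1 q))"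
proof -
  let ?n = "Suc m"
  let ?P = "mat ?n ?n (\<lambda>(i, j). if i = m then y j else if i = j then 1 else 0)"
  let ?Q = "mat ?n ?n (\<lambda>(i, j). if i = m then (if j = m then inverse (y m) else - (inverse (y m) * y j))
     else if i = j then 1 else 0)"
  have prod: "(X * Y) $$ (i, j) = (\<Sum>r\<in>{0..<m}. X $$ (i, r) * Y $$ (r, j)) + X $$ (i, m) * Y $$ (m, j)"
    if "i < ?n" "j < ?n" "X \<in> carrier_mat ?n ?n" "Y \<in> carrier_mat ?n ?n" for X Y :: "quat mat" and i j
    using that by (simp add: scalar_prod_def)
  have delta: "(\<Sum>r\<in>{0..<m}. (if i = r then 1 else 0) * f r) = (if i < m then f i else 0)"
     "(\<Sum>r\<in>{0..<m}. f r * (if r = i then 1 else 0)) = (if i < m then f i else 0)"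
    for f :: "nat \<Rightarrow> quat" and i
    by (simp_all add: if_distrib[of "\<lambda>x. x * _"] if_distrib[of "\<lambda>x. _ * x"] cong: if_cong)
  have PQ: "?P * ?Q = 1\<^sub>m ?n"
  proof (rule eq_matI)
    fix i j assume "i < dim_row (1\<^sub>m ?n :: quat mat)" "j < dim_col (1\<^sub>m ?n :: quat mat)"
    then have ij: "i < ?n" "j < ?n" by auto
    have "(?P * ?Q) $$ (i, j) = (\<Sum>r\<in>{0..<m}. ?P $$ (i, r) * (if r = j then 1 else 0)) + ?P $$ (i, m) * ?Q $$ (m, j)"
      using ij by (subst prod) (auto intro!: sum.cong)
    also have "\<dots> = (if j < m then ?P $$ (i, j) else 0) + ?P $$ (i, m) * ?Q $$ (m, j)"
      by (simp only: delta)
    also have "\<dots> = 1\<^sub>m ?n $$ (i, j)"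
      using ij ym by (auto simp: mult.assoc[symmetric])
    finally show "(?P * ?Q) $$ (i, j) = 1\<^sub>m ?n $$ (i, j)" .
  qed auto
  have QP: "?Q * ?P = 1\<^sub>m ?n"
  proof (rule eq_matI)
    fix i j assume "i < dim_row (1\<^sub>m ?n :: quat mat)" "j < dim_col (1\<^sub>m ?n :: quat mat)"
    then have ij: "i < ?n" "j < ?n" by auto
    have "(?Q * ?P) $$ (i, j) = (\<Sum>r\<in>{0..<m}. ?Q $$ (i, r) * (if r = j then 1 else 0)) + ?Q $$ (i, m) * ?P $$ (m, j)"
      using ij by (subst prod) (auto intro!: sum.cong)
    also have "\<dots> = (if j < m then ?Q $$ (i, j) else 0) + ?Q $$ (i, m) * ?P $$ (m, j)"
      by (simp only: delta)
    also have "\<dots> = 1\<^sub>m ?n $$ (i, j)"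
      using ij ym by (auto simp: less_Suc_eq)
    finally show "(?Q * ?P) $$ (i, j) = 1\<^sub>m ?n $$ (i, j)" .
  qed auto
  let ?T = "?P * A * ?Q"
  have c: "?P \<in> carrier_mat ?n ?n" "?Q \<in> carrier_mat ?n ?n" "?P * A \<in> carrier_mat ?n ?n" "?T \<in> carrier_mat ?n ?n"
    using A by auto
  have PA: "(?P * A) $$ (m, j) = q * ?P $$ (m, j)" if "j < ?n" for j
    using y[OF that] that A by (simp add: scalar_prod_def)
  have last: "?T $$ (m, j) = (if j = m then q else 0)" if "j < ?n" for j
  proof -
    have "?T $$ (m, j) = (\<Sum>r\<in>{0..<?n}. (?P * A) $$ (m, r) * ?Q $$ (r, j))"
      using that A by (simp add: scalar_prod_def)
    also have "\<dots> = (\<Sum>r\<in>{0..<?n}. q * (?P $$ (m, r) * ?Q $$ (r, j)))"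
      by (rule sum.cong) (simp_all add: PA mult.assoc)
    also have "\<dots> = q * (?P * ?Q) $$ (m, j)"
      using that by (simp add: scalar_prod_def sum_distrib_left algebra_simps)
    finally show ?thesis using that by (simp add: PQ)
  qed
  have "similar_mat_wit ?T A ?P ?Q"
    by (rule similar_mat_witI[OF PQ QP refl c(4) A c(1,2)])
  then have "similar_mat A ?T"
    using similar_mat_sym similar_mat_def by blast
  moreover have "?T = four_block_mat (mat m m (\<lambda>(i, j). ?T $$ (i, j))) (mat m 1 (\<lambda>(i, j). ?T $$ (i, m)))
      (0\<^sub>m 1 m) (jordan_block 1 q)" (is "_ = ?F")
  proof (rule eq_matI)
    fix i j assume "i < dim_row ?F" "j < dim_col ?F"
    then have ij: "i < ?n" "j < ?n" by auto
    show "?T $$ (i, j) = ?F $$ (i, j)"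
    proof (cases "i < m")
      case True
      then show ?thesis using ij by (cases "j < m") (auto simp: less_Suc_eq simp del: index_mult_mat(1))
    next
      case False
      then have "i = m" using ij by simp
      then show ?thesis using last[OF ij(2)] ij by (auto simp: less_Suc_eq simp del: index_mult_mat(1))
    qed
  qed (use A in auto)
  ultimately show ?thesis
    by (intro exI[of _ "mat m m (\<lambda>(i, j). ?T $$ (i, j))"] exI[of _ "mat m 1 (\<lambda>(i, j). ?T $$ (i, m))"]) auto
qed

lemma deflate:
  assumes A: "A \<in> carrier_mat (Suc m) (Suc m)"
  shows "\<exists>A' c z. A' \<in> carrier_mat m m \<and> c \<in> carrier_mat m 1 \<and> 0 \<le> Im z \<and>
    similar_mat A (four_block_mat A' c (0\<^sub>m 1 m) (jordan_block 1 (quat_of_complex z)))"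
proof -
  let ?n = "Suc m"
  obtain z y where z: "0 \<le> Im z" and y0: "\<exists>i<?n. y i \<noteq> 0"
    and y: "\<And>j. j < ?n \<Longrightarrow> (\<Sum>i\<in>{0..<?n}. y i * A $$ (i, j)) = quat_of_complex z * y j"
    using left_eigenvector_exists[OF A zero_less_Suc] by blast
  obtain r where r: "r < ?n" "y r \<noteq> 0" using y0 by blast
  define f where "f i = (if i = r then m else if i = m then r else i)" for i
  have f: "f i < ?n" "f (f i) = i" if "i < ?n" for i
    using that r by (auto simp: f_def)
  let ?B = "mat ?n ?n (\<lambda>(i, j). A $$ (f i, f j))"
  have bij: "bij_betw f {0..<?n} {0..<?n}"
    by (rule bij_betwI[of _ _ _ f]) (use f in auto)
  have "(\<Sum>i\<in>{0..<?n}. y (f i) * ?B $$ (i, j)) = quat_of_complex z * y (f j)" if "j < ?n" for j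
  proof -
    have "(\<Sum>i\<in>{0..<?n}. y (f i) * ?B $$ (i, j)) = (\<Sum>i\<in>{0..<?n}. y (f i) * A $$ (f i, f j))"
      by (rule sum.cong) (use that in auto)
    also have "\<dots> = (\<Sum>i\<in>{0..<?n}. y i * A $$ (i, f j))"
      by (rule sum.reindex_bij_betw[OF bij])
    finally show ?thesis using y f that by simp
  qed
  moreover have "y (f m) \<noteq> 0" using r by (simp add: f_def)
  ultimately obtain A' c where *: "A' \<in> carrier_mat m m" "c \<in> carrier_mat m 1"
    "similar_mat ?B (four_block_mat A' c (0\<^sub>m 1 m) (jordan_block 1 (quat_of_complex z)))"
    using deflate_last[of ?B m "\<lambda>i. y (f i)" "quat_of_complex z"] by auto
  have "similar_mat ?B A"
    unfolding similar_mat_def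
    by (intro exI, rule similar_mat_permute[OF A, of f f]) (use f in auto)
  then have "similar_mat A ?B" by (rule similar_mat_sym)
  from similar_mat_trans[OF this *(3)] * z show ?thesis by blast
qed

lemma quat_jordan_matrix_mset:
  "mset xs = mset ys \<Longrightarrow> similar_mat (quat_jordan_matrix xs) (quat_jordan_matrix ys)"
  unfolding quat_jordan_matrix_def by (rule jordan_matrix_mset) simp

text \<open>
  Induction on the size. A left eigenvector splits off one basis vector, the rest is in Jordan
  form by induction, and the remaining border is handled by \<open>bordered_jordan\<close>.
\<close>

lemma quat_jordan_form_exists:
  assumes "A \<in> carrier_mat n n"
  shows "\<exists>bs. (\<forall>(k, z) \<in> set bs. 0 < k \<and> 0 \<le> Im z) \<and> similar_mat A (quat_jordan_matrix bs)"
  using assms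
proof (induction n arbitrary: A)
  case 0
  then have "A = quat_jordan_matrix []" by (intro eq_matI) auto
  then show ?case using similar_mat_refl[OF 0] by (intro exI[of _ "[]"]) auto
next
  case (Suc m)
  obtain A' c z where A': "A' \<in> carrier_mat m m" and c: "c \<in> carrier_mat m 1" and z: "0 \<le> Im z"
    and sim: "similar_mat A (four_block_mat A' c (0\<^sub>m 1 m) (jordan_block 1 (quat_of_complex z)))"
    using deflate[OF Suc.prems] by blast
  obtain bs where bs: "\<forall>(k, z) \<in> set bs. 0 < k \<and> 0 \<le> Im z" "similar_mat A' (quat_jordan_matrix bs)"
    using Suc.IH[OF A'] by blast
  let ?bs = "sort_key fst bs"
  have sim': "similar_mat A' (quat_jordan_matrix ?bs)"
    using similar_mat_trans[OF bs(2) quat_jordan_matrix_mset[of bs ?bs]] by simp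
  then have m: "sum_list (map fst ?bs) = m"
    using similar_mat_dim_row[OF sim'] A' by simp
  obtain B0 where B0: "B0 \<in> carrier_mat m 1"
    "similar_mat (four_block_mat A' c (0\<^sub>m 1 m) (jordan_block 1 (quat_of_complex z)))
      (four_block_mat (quat_jordan_matrix ?bs) B0 (0\<^sub>m 1 m) (jordan_block 1 (quat_of_complex z)))"
    using similar_mat_four_block_0_ex[OF sim' similar_mat_refl[OF jordan_block_carrier] c A'
        jordan_block_carrier] by blast
  have col: "B0 = lastcol m 1 (\<lambda>i. B0 $$ (i, 0))"
    by (rule eq_matI) (use B0 in auto)
  have "\<forall>(k, w) \<in> set ?bs. 0 < k \<and> 0 \<le> Im w" using bs by simp
  then obtain bs' k where k: "0 < k" "\<forall>(k, w) \<in> set bs'. 0 < k \<and> 0 \<le> Im w"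
    and sfl: "similar_fixing_last
      (four_block_mat (quat_jordan_matrix ?bs) B0 (0\<^sub>m 1 m) (jordan_block 1 (quat_of_complex z)))
      (quat_jordan_matrix (bs' @ [(k, z)]))"
    using bordered_jordan[of ?bs z "\<lambda>i. B0 $$ (i, 0)"] z unfolding m col[symmetric] by auto
  have "similar_mat A (quat_jordan_matrix (bs' @ [(k, z)]))"
    using sim B0(2) similar_fixing_last_imp_similar[OF sfl] similar_mat_trans by blast
  then show ?case using k z by (intro exI[of _ "bs' @ [(k, z)]"]) auto
qed

section \<open>Right eigenvalues and similarity\<close>

lemma vec_rmult_index [simp]: "i < dim_vec x \<Longrightarrow> vec_rmult x a $ i = x $ i * a"
  by (simp add: vec_rmult_def)

lemma vec_rmult_dim [simp]: "dim_vec (vec_rmult x a) = dim_vec x"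
  by (simp add: vec_rmult_def)

lemma vec_rmult_carrier [simp]: "vec_rmult x a \<in> carrier_vec n \<longleftrightarrow> x \<in> carrier_vec n"
  unfolding carrier_vec_def by simp

lemma mult_mat_vec_rmult:
  fixes A :: "'a :: semiring_0 mat"
  assumes "A \<in> carrier_mat n m" "x \<in> carrier_vec m"
  shows "A *\<^sub>v vec_rmult x a = vec_rmult (A *\<^sub>v x) a"
  by (rule eq_vecI) (use assms in \<open>auto simp: scalar_prod_def sum_distrib_right mult.assoc\<close>)

lemma mult_mat_vec_inverse:
  fixes P :: "'a :: semiring_1 mat"
  assumes "P \<in> carrier_mat n n" "Q \<in> carrier_mat n n" "P * Q = 1\<^sub>m n" "x \<in> carrier_vec n"
  shows "P *\<^sub>v (Q *\<^sub>v x) = x"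
  using assms by (metis assoc_mult_mat_vec one_mult_mat_vec)

lemma right_eigenvector_similar:
  fixes A :: "'a :: semiring_1 mat"
  assumes A: "A \<in> carrier_mat n n" and wit: "similar_mat_wit A B P Q"
    and x: "x \<in> carrier_vec n" "x \<noteq> 0\<^sub>v n" "A *\<^sub>v x = vec_rmult x a"
  shows "Q *\<^sub>v x \<in> carrier_vec n" "Q *\<^sub>v x \<noteq> 0\<^sub>v n" "B *\<^sub>v (Q *\<^sub>v x) = vec_rmult (Q *\<^sub>v x) a"
proof -
  note w = similar_mat_witD2[OF A wit]
  note w' = similar_mat_witD2[OF w(5) similar_mat_wit_sym[OF wit]]
  show "Q *\<^sub>v x \<in> carrier_vec n" using w(7) x(1) by simp
  show "Q *\<^sub>v x \<noteq> 0\<^sub>v n"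
  proof
    assume "Q *\<^sub>v x = 0\<^sub>v n"
    then have "P *\<^sub>v (Q *\<^sub>v x) = 0\<^sub>v n" using w(6) by auto
    then show False using mult_mat_vec_inverse[OF w(6,7,1) x(1)] x(2) by simp
  qed
  have "B *\<^sub>v (Q *\<^sub>v x) = (Q * A * P) *\<^sub>v (Q *\<^sub>v x)" using w'(3) by simp
  also have "\<dots> = (Q * A) *\<^sub>v (P *\<^sub>v (Q *\<^sub>v x))"
    by (rule assoc_mult_mat_vec[of _ n n _ n]) (use w(4,6,7) x in auto)
  also have "\<dots> = (Q * A) *\<^sub>v x" using mult_mat_vec_inverse[OF w(6,7,1) x(1)] by simp
  also have "\<dots> = Q *\<^sub>v (A *\<^sub>v x)" by (rule assoc_mult_mat_vec[OF w(7) A x(1)])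
  also have "\<dots> = vec_rmult (Q *\<^sub>v x) a" unfolding x(3) by (rule mult_mat_vec_rmult[OF w(7) x(1)])
  finally show "B *\<^sub>v (Q *\<^sub>v x) = vec_rmult (Q *\<^sub>v x) a" .
qed

lemma right_eigenvalue_similar:
  assumes "similar_mat A B" "right_eigenvalue A a"
  shows "right_eigenvalue B a"
proof -
  obtain P Q where wit: "similar_mat_wit A B P Q" using assms by (auto simp: similar_mat_def)
  note w = similar_mat_witD(4,5)[OF refl wit]
  obtain x where "x \<in> carrier_vec (dim_row A)" "x \<noteq> 0\<^sub>v (dim_row A)" "A *\<^sub>v x = vec_rmult x a"
    using assms(2) by (auto simp: right_eigenvalue_def)
  from right_eigenvector_similar[OF w(1) wit this] show ?thesis
    using similar_mat_dim_row[OF assms(1)] unfolding right_eigenvalue_def by auto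
qed

lemma right_eigenvalue_first_column:
  assumes M: "M \<in> carrier_mat n n" and n: "0 < n"
    and col: "\<And>i. i < n \<Longrightarrow> M $$ (i, 0) = (if i = 0 then a else 0)"
  shows "right_eigenvalue M a"
proof -
  have "M *\<^sub>v unit_vec n 0 = vec_rmult (unit_vec n 0) a"
    using M n col by (intro eq_vecI) auto
  moreover have "unit_vec n 0 \<noteq> (0\<^sub>v n :: quat vec)"
    using n by (metis index_unit_vec(2) index_zero_vec(1) zero_neq_one)
  ultimately show ?thesis
    using M unfolding right_eigenvalue_def by (intro bexI[of _ "unit_vec n 0"]) auto
qed

lemma quat_jordan_matrix_right_eigenvalue:
  assumes "(k, z) \<in> set bs" "0 < k"
  shows "right_eigenvalue (quat_jordan_matrix bs) (quat_of_complex z)"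
proof -
  obtain us vs where bs: "bs = us @ (k, z) # vs" using assms(1) by (meson split_list)
  have "right_eigenvalue (quat_jordan_matrix ((k, z) # us @ vs)) (quat_of_complex z)"
    by (rule right_eigenvalue_first_column[OF quat_jordan_matrix_carrier])
      (use assms(2) in \<open>auto simp: quat_jordan_matrix_Cons\<close>)
  moreover have "similar_mat (quat_jordan_matrix ((k, z) # us @ vs)) (quat_jordan_matrix bs)"
    by (rule quat_jordan_matrix_mset) (simp add: bs)
  ultimately show ?thesis using right_eigenvalue_similar by blast
qed

text \<open>
  The multiplicities are defined through an arbitrarily chosen Jordan form; existence is what
  gives them meaning.
\<close>

lemma quat_jordan_nf_exists:
  assumes A: "A \<in> carrier_mat n n"
  shows "\<exists>bs. quat_jordan_nf A bs"
proof -
  obtain bs where bs: "\<forall>(k, z) \<in> set bs. 0 < k \<and> 0 \<le> Im z" and sim: "similar_mat A (quat_jordan_matrix bs)"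
    using quat_jordan_form_exists[OF A] by blast
  have "standard_eigenvalue A z" if "(k, z) \<in> set bs" for k z
    using that bs quat_jordan_matrix_right_eigenvalue[of k z bs]
      right_eigenvalue_similar[OF similar_mat_sym[OF sim]]
    unfolding standard_eigenvalue_def by auto
  then show ?thesis
    using bs sim unfolding quat_jordan_nf_def jordan_nf_def quat_jordan_matrix_def[symmetric]
    by (intro exI[of _ bs]) force
qed

section \<open>Eigenvalues of Jordan matrices\<close>

text \<open>
  Read the eigenvalue equation in the row of the last nonzero entry of the eigenvector.
\<close>

lemma upper_triangular_right_eigenvalue:
  fixes T :: "'a :: semiring_0 mat"
  assumes T: "T \<in> carrier_mat n n" and tri: "\<And>i j. j < i \<Longrightarrow> i < n \<Longrightarrow> T $$ (i, j) = 0"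
    and x: "x \<in> carrier_vec n" "x \<noteq> 0\<^sub>v n" "T *\<^sub>v x = vec_rmult x a"
  shows "\<exists>i<n. x $ i \<noteq> 0 \<and> T $$ (i, i) * x $ i = x $ i * a"
proof -
  let ?S = "{i. i < n \<and> x $ i \<noteq> 0}"
  have fin: "finite ?S" by simp
  have "?S \<noteq> {}"
  proof
    assume "?S = {}"
    then have "x = 0\<^sub>v n" using x(1) by (intro eq_vecI) auto
    then show False using x(2) by simp
  qed
  then have M: "Max ?S \<in> ?S" by (rule Max_in[OF fin])
  define i where "i = Max ?S"
  have i: "i < n" "x $ i \<noteq> 0" using M by (auto simp: i_def)
  have zero: "x $ j = 0" if "i < j" "j < n" for j
    using Max_ge[OF fin, of j] that unfolding i_def[symmetric] by force
  have "x $ i * a = (T *\<^sub>v x) $ i" using x i by simp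
  also have "\<dots> = (\<Sum>j\<in>{0..<n}. T $$ (i, j) * x $ j)"
    using T x(1) i by (simp add: scalar_prod_def)
  also have "\<dots> = (\<Sum>j\<in>{0..<n}. if j = i then T $$ (i, i) * x $ i else 0)"
  proof (rule sum.cong)
    fix j assume "j \<in> {0..<n}"
    then show "T $$ (i, j) * x $ j = (if j = i then T $$ (i, i) * x $ i else 0)"
      using tri[of j i] zero[of j] i by (cases j i rule: linorder_cases) auto
  qed simp
  also have "\<dots> = T $$ (i, i) * x $ i" using i by simp
  finally show ?thesis using i by auto
qed

lemma quat_jordan_matrix_upper_triangular:
  "i < sum_list (map fst bs) \<Longrightarrow> j < i \<Longrightarrow> quat_jordan_matrix bs $$ (i, j) = 0"
  unfolding quat_jordan_matrix_def by (rule jordan_matrix_upper_triangular) auto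

lemma quat_jordan_matrix_diagonal:
  "i < sum_list (map fst bs) \<Longrightarrow> \<exists>w \<in> snd ` set bs. quat_jordan_matrix bs $$ (i, i) = quat_of_complex w"
proof (induction bs arbitrary: i)
  case (Cons b bs)
  obtain k z where b: "b = (k, z)" by force
  show ?case
  proof (cases "i < k")
    case True
    then show ?thesis using b Cons.prems by (auto simp: quat_jordan_matrix_Cons)
  next
    case False
    then have "i - k < sum_list (map fst bs)" using Cons.prems b by auto
    from Cons.IH[OF this] show ?thesis
      using False b Cons.prems by (auto simp: quat_jordan_matrix_Cons)
  qed
qed simp

lemma jordan_right_eigenvalue_cases:
  assumes sim: "similar_mat A (quat_jordan_matrix bs)" and "right_eigenvalue A a"
  shows "\<exists>w \<in> snd ` set bs. \<exists>u. u \<noteq> 0 \<and> quat_of_complex w * u = u * a"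
proof -
  let ?J = "quat_jordan_matrix bs" and ?n = "sum_list (map fst bs)"
  have "right_eigenvalue ?J a" by (rule right_eigenvalue_similar[OF assms])
  then obtain x where x: "x \<in> carrier_vec ?n" "x \<noteq> 0\<^sub>v ?n" "?J *\<^sub>v x = vec_rmult x a"
    by (auto simp: right_eigenvalue_def)
  from upper_triangular_right_eigenvalue[OF quat_jordan_matrix_carrier _ x]
  obtain i where i: "i < ?n" "x $ i \<noteq> 0" "?J $$ (i, i) * x $ i = x $ i * a"
    using quat_jordan_matrix_upper_triangular by blast
  then show ?thesis using quat_jordan_matrix_diagonal[OF i(1)] by metis
qed

lemma quat_jordan_matrix_sylvester:
  assumes z: "0 \<le> Im z" and bs: "\<forall>(k, w) \<in> set bs. 0 \<le> Im w \<and> w \<noteq> z"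
    and c: "c \<in> carrier_vec (sum_list (map fst bs))"
  shows "\<exists>x \<in> carrier_vec (sum_list (map fst bs)).
    quat_jordan_matrix bs *\<^sub>v x + c = vec_rmult x (quat_of_complex z)"
proof -
  let ?J = "quat_jordan_matrix bs" and ?n = "sum_list (map fst bs)" and ?Z = "quat_of_complex z"
  have "\<exists>s. \<forall>i<?n. c $ i + ((\<Sum>j\<in>{i..<?n}. ?J $$ (i, j) * s j) - s i * ?Z) = 0"
  proof (rule upper_triangular_solve[where R = "\<lambda>i q. q = 0"])
    fix i q assume "i < ?n"
    then obtain w where "w \<in> snd ` set bs" "?J $$ (i, i) = quat_of_complex w"
      using quat_jordan_matrix_diagonal by blast
    with bs quat_sylvester_distinct[of w z q] z
    show "\<exists>s. q + (?J $$ (i, i) * s - s * ?Z) = 0" by force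
  qed
  then obtain s where s: "\<And>i. i < ?n \<Longrightarrow> c $ i + ((\<Sum>j\<in>{i..<?n}. ?J $$ (i, j) * s j) - s i * ?Z) = 0"
    by blast
  have "?J *\<^sub>v vec ?n s + c = vec_rmult (vec ?n s) ?Z"
  proof (rule eq_vecI)
    fix i assume "i < dim_vec (vec_rmult (vec ?n s) ?Z)"
    then have i: "i < ?n" by simp
    have "(?J *\<^sub>v vec ?n s) $ i = (\<Sum>j\<in>{0..<?n}. ?J $$ (i, j) * s j)"
      using i by (simp add: scalar_prod_def)
    also have "\<dots> = (\<Sum>j\<in>{i..<?n}. ?J $$ (i, j) * s j)"
      by (rule sum.mono_neutral_right) (use i quat_jordan_matrix_upper_triangular[of i bs] in auto)
    finally show "(?J *\<^sub>v vec ?n s + c) $ i = vec_rmult (vec ?n s) ?Z $ i"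
      using s[OF i] i c by (simp add: algebra_simps)
  qed (use c in auto)
  then show ?thesis by (intro bexI[of _ "vec ?n s"]) auto
qed

text \<open>
  An eigenvalue is similar to some diagonal entry, and similar complex numbers in the closed
  upper half plane are equal.
\<close>

lemma quat_jordan_matrix_no_eigenvalue:
  assumes z: "0 \<le> Im z" and bs: "\<forall>(k, w) \<in> set bs. 0 \<le> Im w \<and> w \<noteq> z"
  shows "\<not> right_eigenvalue (quat_jordan_matrix bs) (quat_of_complex z)"
proof
  assume "right_eigenvalue (quat_jordan_matrix bs) (quat_of_complex z)"
  from jordan_right_eigenvalue_cases[OF similar_mat_refl[OF quat_jordan_matrix_carrier] this]
  obtain w u where w: "w \<in> snd ` set bs" and u: "u \<noteq> 0" "quat_of_complex w * u = u * quat_of_complex z"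
    by blast
  then have wz: "0 \<le> Im w" "w \<noteq> z" using bs by auto
  obtain a b where ab: "u = quat_pair a b" by (rule quat_pair_cases)
  have "w \<noteq> cnj z" using wz z by (auto simp: complex_eq_iff)
  then show False
    using u wz by (auto simp: ab quat_of_complex_eq_pair zero_quat_eq_pair mult.commute)
qed

section \<open>Dual eigenvalues as pairs of quaternionic equations\<close>

text \<open>
  The standard and the dual part of the equation $(M + N\epsilon)(x + y\epsilon) = (x +
  y\epsilon)(\mu + \nu\epsilon)$.
\<close>

definition dual_eigenpair :: "nat \<Rightarrow> quat mat \<Rightarrow> quat mat \<Rightarrow> quat \<Rightarrow> quat \<Rightarrow> bool" where
  "dual_eigenpair n M N \<mu> \<nu> \<longleftrightarrow> (\<exists>x \<in> carrier_vec n. \<exists>y \<in> carrier_vec n. x \<noteq> 0\<^sub>v n \<and>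
     M *\<^sub>v x = vec_rmult x \<mu> \<and> M *\<^sub>v y + N *\<^sub>v x = vec_rmult y \<mu> + vec_rmult x \<nu>)"

lemma std_part_simps [simp]:
  "std_part 0 = 0" "dual_part 0 = 0" "std_part (x + y) = std_part x + std_part y"
  "dual_part (x + y) = dual_part x + dual_part y" "std_part (x * y) = std_part x * std_part y"
  "dual_part (x * y) = std_part x * dual_part y + dual_part x * std_part y"
  "std_part 1 = 1" "dual_part 1 = 0"
  by (simp_all add: dquat_defs)

lemma std_part_sum: "std_part (\<Sum>i\<in>S. f i) = (\<Sum>i\<in>S. std_part (f i))"
  and dual_part_sum: "dual_part (\<Sum>i\<in>S. f i) = (\<Sum>i\<in>S. dual_part (f i))"
  by (induction S rule: infinite_finite_induct) auto

lemma dual_right_eigenvalue_iff: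
  assumes A: "A \<in> carrier_mat n n"
  shows "dual_right_eigenvalue A a \<longleftrightarrow>
    dual_eigenpair n (map_mat std_part A) (map_mat dual_part A) (std_part a) (dual_part a)"
proof -
  let ?M = "map_mat std_part A" and ?N = "map_mat dual_part A"
  have eq: "A *\<^sub>v x = vec_rmult x a \<longleftrightarrow>
      ?M *\<^sub>v map_vec std_part x = vec_rmult (map_vec std_part x) (std_part a) \<and>
      ?M *\<^sub>v map_vec dual_part x + ?N *\<^sub>v map_vec std_part x
        = vec_rmult (map_vec dual_part x) (std_part a) + vec_rmult (map_vec std_part x) (dual_part a)"
    if x: "x \<in> carrier_vec n" for x
  proof -
    have 1: "(?M *\<^sub>v map_vec std_part x) $ i = std_part ((A *\<^sub>v x) $ i)"
      "(?M *\<^sub>v map_vec dual_part x + ?N *\<^sub>v map_vec std_part x) $ i = dual_part ((A *\<^sub>v x) $ i)"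
      "(vec_rmult (map_vec std_part x) (std_part a)) $ i = std_part (vec_rmult x a $ i)"
      "(vec_rmult (map_vec dual_part x) (std_part a) + vec_rmult (map_vec std_part x) (dual_part a)) $ i
        = dual_part (vec_rmult x a $ i)"
      if "i < n" for i
      using that A x by (simp_all add: scalar_prod_def std_part_sum dual_part_sum sum.distrib add.commute)
    show ?thesis
    proof
      assume "A *\<^sub>v x = vec_rmult x a"
      then show "?M *\<^sub>v map_vec std_part x = vec_rmult (map_vec std_part x) (std_part a) \<and>
      ?M *\<^sub>v map_vec dual_part x + ?N *\<^sub>v map_vec std_part x
        = vec_rmult (map_vec dual_part x) (std_part a) + vec_rmult (map_vec std_part x) (dual_part a)"
        by (intro conjI eq_vecI) (use 1 A x in \<open>simp_all del: index_mult_mat_vec index_add_vec(1) vec_rmult_index\<close>)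
    next
      assume r: "?M *\<^sub>v map_vec std_part x = vec_rmult (map_vec std_part x) (std_part a) \<and>
      ?M *\<^sub>v map_vec dual_part x + ?N *\<^sub>v map_vec std_part x
        = vec_rmult (map_vec dual_part x) (std_part a) + vec_rmult (map_vec std_part x) (dual_part a)"
      show "A *\<^sub>v x = vec_rmult x a"
      proof (rule eq_vecI)
        fix i assume "i < dim_vec (vec_rmult x a)"
        then have i: "i < n" using x by simp
        show "(A *\<^sub>v x) $ i = vec_rmult x a $ i"
          using 1[OF i] r by (intro dquat.expand) simp
      qed (use A x in auto)
    qed
  qed
  show ?thesis
  proof
    assume "dual_right_eigenvalue A a"
    then obtain x where x: "x \<in> carrier_vec n" "map_vec std_part x \<noteq> 0\<^sub>v n" "A *\<^sub>v x = vec_rmult x a"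
      using A unfolding dual_right_eigenvalue_def appreciable_def by fastforce
    then show "dual_eigenpair n ?M ?N (std_part a) (dual_part a)"
      unfolding dual_eigenpair_def using eq[OF x(1)]
      by (intro bexI[of _ "map_vec std_part x"] bexI[of _ "map_vec dual_part x"]) auto
  next
    assume "dual_eigenpair n ?M ?N (std_part a) (dual_part a)"
    then obtain x y where x: "x \<in> carrier_vec n" "y \<in> carrier_vec n" "x \<noteq> 0\<^sub>v n"
      "?M *\<^sub>v x = vec_rmult x (std_part a)"
      "?M *\<^sub>v y + ?N *\<^sub>v x = vec_rmult y (std_part a) + vec_rmult x (dual_part a)"
      unfolding dual_eigenpair_def by blast
    let ?x = "vec n (\<lambda>i. DQuat (x $ i) (y $ i))"
    have xy: "map_vec std_part ?x = x" "map_vec dual_part ?x = y"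
      using x by auto
    have "A *\<^sub>v ?x = vec_rmult ?x a" using eq[of ?x] x unfolding xy by simp
    then show "dual_right_eigenvalue A a"
      unfolding dual_right_eigenvalue_def appreciable_def
      using x A xy by (intro bexI[of _ ?x]) auto
  qed
qed

lemma dual_eigenpair_similar_imp:
  assumes M: "M \<in> carrier_mat n n" and N: "N \<in> carrier_mat n n" and wit: "similar_mat_wit M D P Q"
    and pair: "dual_eigenpair n M N \<mu> \<nu>"
  shows "dual_eigenpair n D (Q * N * P) \<mu> \<nu>"
proof -
  note w = similar_mat_witD2[OF M wit]
  note w' = similar_mat_witD2[OF w(5) similar_mat_wit_sym[OF wit]]
  obtain x y where x: "x \<in> carrier_vec n" "x \<noteq> 0\<^sub>v n" "M *\<^sub>v x = vec_rmult x \<mu>"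
    and y: "y \<in> carrier_vec n" "M *\<^sub>v y + N *\<^sub>v x = vec_rmult y \<mu> + vec_rmult x \<nu>"
    using pair unfolding dual_eigenpair_def by blast
  note Qx = right_eigenvector_similar[OF M wit x]
  have conj: "(Q * X * P) *\<^sub>v (Q *\<^sub>v v) = Q *\<^sub>v (X *\<^sub>v v)"
    if X: "X \<in> carrier_mat n n" and v: "v \<in> carrier_vec n" for X v
  proof -
    have "(Q * X * P) *\<^sub>v (Q *\<^sub>v v) = (Q * X) *\<^sub>v (P *\<^sub>v (Q *\<^sub>v v))"
      by (rule assoc_mult_mat_vec[of _ n n _ n]) (use w(6,7) X v in auto)
    also have "\<dots> = Q *\<^sub>v (X *\<^sub>v v)"
      unfolding mult_mat_vec_inverse[OF w(6,7,1) v] by (rule assoc_mult_mat_vec[OF w(7) X v])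
    finally show ?thesis .
  qed
  have D: "D = Q * M * P" by (rule w'(3))
  have car: "M *\<^sub>v y \<in> carrier_vec n" "N *\<^sub>v x \<in> carrier_vec n" "vec_rmult y \<mu> \<in> carrier_vec n"
    "vec_rmult x \<nu> \<in> carrier_vec n"
    using M N x(1) y(1) by auto
  have "D *\<^sub>v (Q *\<^sub>v y) + (Q * N * P) *\<^sub>v (Q *\<^sub>v x) = Q *\<^sub>v (M *\<^sub>v y) + Q *\<^sub>v (N *\<^sub>v x)"
    unfolding D conj[OF M y(1)] conj[OF N x(1)] ..
  also have "\<dots> = Q *\<^sub>v (vec_rmult y \<mu> + vec_rmult x \<nu>)"
    unfolding y(2)[symmetric] by (rule mult_add_distrib_mat_vec[OF w(7) car(1,2), symmetric])
  also have "\<dots> = vec_rmult (Q *\<^sub>v y) \<mu> + vec_rmult (Q *\<^sub>v x) \<nu>"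
    unfolding mult_add_distrib_mat_vec[OF w(7) car(3,4)] mult_mat_vec_rmult[OF w(7) x(1)]
      mult_mat_vec_rmult[OF w(7) y(1)] ..
  finally show ?thesis
    unfolding dual_eigenpair_def using Qx w(7) y(1)
    by (intro bexI[of _ "Q *\<^sub>v x"] bexI[of _ "Q *\<^sub>v y"]) auto
qed

lemma dual_eigenpair_similar:
  assumes M: "M \<in> carrier_mat n n" and N: "N \<in> carrier_mat n n" and wit: "similar_mat_wit M D P Q"
  shows "dual_eigenpair n M N \<mu> \<nu> \<longleftrightarrow> dual_eigenpair n D (Q * N * P) \<mu> \<nu>"
proof
  show "dual_eigenpair n M N \<mu> \<nu> \<Longrightarrow> dual_eigenpair n D (Q * N * P) \<mu> \<nu>"
    by (rule dual_eigenpair_similar_imp[OF assms])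
next
  note w = similar_mat_witD2[OF M wit]
  have QNP: "Q * N * P \<in> carrier_mat n n" using w(6,7) N by auto
  have "P * (Q * N * P) * Q = (P * Q) * N * (P * Q)"
    using w(6,7) N by (simp add: assoc_mult_mat[of _ n n _ n _ n])
  also have "\<dots> = N" using N by (simp add: w(1))
  finally have N': "P * (Q * N * P) * Q = N" .
  assume "dual_eigenpair n D (Q * N * P) \<mu> \<nu>"
  from dual_eigenpair_similar_imp[OF w(5) QNP similar_mat_wit_sym[OF wit] this]
  show "dual_eigenpair n M N \<mu> \<nu>" unfolding N' .
qed

section \<open>Compression to the eigenspace\<close>

text \<open>
  What the dual equations become on the eigenspace of \<open>\<mu>\<close>, when
  \<open>\<mu>\<close> acts there as a scalar: the first-order perturbation equation, with
  \<open>B\<close> the compressed dual part. Eigenvectors have entries commuting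
  with \<open>\<mu>\<close>, and \<open>w\<close> is the component in the eigenspace of the
  dual part of the dual eigenvector.
\<close>

definition compressed_eigenpair :: "nat \<Rightarrow> quat mat \<Rightarrow> quat \<Rightarrow> quat \<Rightarrow> bool" where
  "compressed_eigenpair k B \<mu> \<nu> \<longleftrightarrow> (\<exists>y \<in> carrier_vec k. \<exists>w \<in> carrier_vec k. y \<noteq> 0\<^sub>v k \<and>
     (\<forall>i<k. \<mu> * y $ i = y $ i * \<mu>) \<and>
     (\<forall>i<k. \<mu> * w $ i - w $ i * \<mu> + (B *\<^sub>v y) $ i = y $ i * \<nu>))"

text \<open>
  Since \<open>\<mu>\<close> is no eigenvalue of \<open>J\<close>, the standard part of an
  eigenvector lives in the first block; and since $x \mapsto J x - x \mu$ is onto, the lower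
  half of the dual equation can always be solved and imposes no condition.
\<close>

lemma dual_eigenpair_block:
  assumes J: "J \<in> carrier_mat r r" and no: "\<not> right_eigenvalue J \<mu>"
    and solve: "\<And>c. c \<in> carrier_vec r \<Longrightarrow> \<exists>x \<in> carrier_vec r. J *\<^sub>v x + c = vec_rmult x \<mu>"
    and N: "N \<in> carrier_mat (k + r) (k + r)"
  shows "dual_eigenpair (k + r)
      (four_block_mat (mat k k (\<lambda>(i, j). if i = j then \<mu> else 0)) (0\<^sub>m k r) (0\<^sub>m r k) J) N \<mu> \<nu>
    \<longleftrightarrow> compressed_eigenpair k (mat k k (\<lambda>(i, j). N $$ (i, j))) \<mu> \<nu>"
proof -
  let ?L = "mat k k (\<lambda>(i, j). if i = j then \<mu> else 0)"
  let ?D = "four_block_mat ?L (0\<^sub>m k r) (0\<^sub>m r k) J"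
  let ?B = "mat k k (\<lambda>(i, j). N $$ (i, j))"
  let ?N12 = "mat k r (\<lambda>(i, j). N $$ (i, k + j))"
  let ?N21 = "mat r k (\<lambda>(i, j). N $$ (k + i, j))"
  let ?N22 = "mat r r (\<lambda>(i, j). N $$ (k + i, k + j))"
  have L: "?L \<in> carrier_mat k k" by simp
  have Neq: "N = four_block_mat ?B ?N12 ?N21 ?N22"
    by (rule eq_matI) (use N in auto)
  have Lv: "(?L *\<^sub>v v) $ i = \<mu> * v $ i" if "v \<in> carrier_vec k" "i < k" for v i
    using that by (simp add: scalar_prod_def if_distrib[of "\<lambda>x. x * _"] cong: if_cong)
  have rm: "vec_rmult (u @\<^sub>v v) a = vec_rmult u a @\<^sub>v vec_rmult v a" for u v and a :: quat
    by (rule eq_vecI) auto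
  have Dv: "?D *\<^sub>v (u @\<^sub>v v) = ?L *\<^sub>v u @\<^sub>v J *\<^sub>v v"
    if "u \<in> carrier_vec k" "v \<in> carrier_vec r" for u v
    by (rule mult_mat_vec_split[OF L J that])
  have Nv: "N *\<^sub>v (u @\<^sub>v v) = (?B *\<^sub>v u + ?N12 *\<^sub>v v) @\<^sub>v (?N21 *\<^sub>v u + ?N22 *\<^sub>v v)"
    if "u \<in> carrier_vec k" "v \<in> carrier_vec r" for u v
    by (subst Neq, rule four_block_mat_mult_vec) (use that in auto)
  have zero: "0\<^sub>v k @\<^sub>v 0\<^sub>v r = (0\<^sub>v (k + r) :: quat vec)" by (rule eq_vecI) auto
  show ?thesis
  proof
    assume "dual_eigenpair (k + r) ?D N \<mu> \<nu>"
    then obtain x y where x: "x \<in> carrier_vec (k + r)" "x \<noteq> 0\<^sub>v (k + r)" "?D *\<^sub>v x = vec_rmult x \<mu>"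
      and y: "y \<in> carrier_vec (k + r)" "?D *\<^sub>v y + N *\<^sub>v x = vec_rmult y \<mu> + vec_rmult x \<nu>"
      unfolding dual_eigenpair_def by blast
    obtain x1 x2 where x12: "x = x1 @\<^sub>v x2" "x1 \<in> carrier_vec k" "x2 \<in> carrier_vec r"
      using vec_first_last_append[OF x(1)] by (metis vec_first_carrier vec_last_carrier)
    obtain y1 y2 where y12: "y = y1 @\<^sub>v y2" "y1 \<in> carrier_vec k" "y2 \<in> carrier_vec r"
      using vec_first_last_append[OF y(1)] by (metis vec_first_carrier vec_last_carrier)
    have "?L *\<^sub>v x1 @\<^sub>v J *\<^sub>v x2 = vec_rmult x1 \<mu> @\<^sub>v vec_rmult x2 \<mu>"
      using x(3) unfolding x12(1) Dv[OF x12(2,3)] rm .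
    then have eq1: "?L *\<^sub>v x1 = vec_rmult x1 \<mu>" and eq2: "J *\<^sub>v x2 = vec_rmult x2 \<mu>"
      using append_vec_eq[of "?L *\<^sub>v x1" k "vec_rmult x1 \<mu>"] x12 L by auto
    have x2: "x2 = 0\<^sub>v r"
      using no eq2 x12(3) J unfolding right_eigenvalue_def by auto
    have x1: "x1 \<noteq> 0\<^sub>v k" using x(2) unfolding x12(1) x2 using zero by auto
    have "(?L *\<^sub>v y1 @\<^sub>v J *\<^sub>v y2) + ((?B *\<^sub>v x1 + ?N12 *\<^sub>v x2) @\<^sub>v (?N21 *\<^sub>v x1 + ?N22 *\<^sub>v x2))
      = (vec_rmult y1 \<mu> @\<^sub>v vec_rmult y2 \<mu>) + (vec_rmult x1 \<nu> @\<^sub>v vec_rmult x2 \<nu>)"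
      using y(2) unfolding x12(1) y12(1) Dv[OF y12(2,3)] Nv[OF x12(2,3)] rm .
    then have main: "((?L *\<^sub>v y1 @\<^sub>v J *\<^sub>v y2) + ((?B *\<^sub>v x1 + ?N12 *\<^sub>v x2) @\<^sub>v (?N21 *\<^sub>v x1 + ?N22 *\<^sub>v x2))) $ i
      = ((vec_rmult y1 \<mu> @\<^sub>v vec_rmult y2 \<mu>) + (vec_rmult x1 \<nu> @\<^sub>v vec_rmult x2 \<nu>)) $ i" for i
      by simp
    have top: "\<mu> * y1 $ i + (?B *\<^sub>v x1) $ i = y1 $ i * \<mu> + x1 $ i * \<nu>" if "i < k" for i
    proof -
      have "?N12 *\<^sub>v x2 = 0\<^sub>v k" unfolding x2 by (rule eq_vecI) auto
      then show ?thesis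
        using main[of i] that x12(2,3) y12(2,3) J
        by (simp add: Lv[OF y12(2)] del: index_mult_mat_vec)
    qed
    show "compressed_eigenpair k ?B \<mu> \<nu>"
      unfolding compressed_eigenpair_def
    proof (intro bexI conjI allI impI)
      fix i assume i: "i < k"
      show "\<mu> * x1 $ i = x1 $ i * \<mu>"
        using arg_cong[OF eq1, of "\<lambda>v. v $ i"] Lv[OF x12(2) i] i x12(2) by simp
      show "\<mu> * y1 $ i - y1 $ i * \<mu> + (?B *\<^sub>v x1) $ i = x1 $ i * \<nu>"
        using top[OF i] by (simp add: algebra_simps)
    qed (use x1 x12 y12 in auto)
  next
    assume "compressed_eigenpair k ?B \<mu> \<nu>"
    then obtain x1 y1 where x1: "x1 \<in> carrier_vec k" "x1 \<noteq> 0\<^sub>v k"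
        "\<And>i. i < k \<Longrightarrow> \<mu> * x1 $ i = x1 $ i * \<mu>"
      and y1: "y1 \<in> carrier_vec k"
        "\<And>i. i < k \<Longrightarrow> \<mu> * y1 $ i - y1 $ i * \<mu> + (?B *\<^sub>v x1) $ i = x1 $ i * \<nu>"
      unfolding compressed_eigenpair_def by blast
    have N21: "?N21 *\<^sub>v x1 \<in> carrier_vec r"
      by (rule mult_mat_vec_carrier[OF _ x1(1)]) simp
    then obtain y2 where y2: "y2 \<in> carrier_vec r" "J *\<^sub>v y2 + ?N21 *\<^sub>v x1 = vec_rmult y2 \<mu>"
      using solve by blast
    let ?x = "x1 @\<^sub>v 0\<^sub>v r" and ?y = "y1 @\<^sub>v y2"
    have z: "0\<^sub>v r \<in> carrier_vec r" by simp
    have xne: "?x \<noteq> 0\<^sub>v (k + r)"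
      unfolding zero[symmetric] using append_vec_eq[of x1 k "0\<^sub>v k"] x1 by auto
    have "?L *\<^sub>v x1 = vec_rmult x1 \<mu>"
      by (rule eq_vecI) (use x1 Lv in \<open>simp_all del: index_mult_mat_vec\<close>)
    moreover have "J *\<^sub>v 0\<^sub>v r = vec_rmult (0\<^sub>v r) \<mu>"
      using J by (intro eq_vecI) auto
    ultimately have eq1: "?D *\<^sub>v ?x = vec_rmult ?x \<mu>"
      unfolding Dv[OF x1(1) z] rm by simp
    have "?L *\<^sub>v y1 + (?B *\<^sub>v x1 + ?N12 *\<^sub>v 0\<^sub>v r) = vec_rmult y1 \<mu> + vec_rmult x1 \<nu>"
    proof (rule eq_vecI)
      fix i assume "i < dim_vec (vec_rmult y1 \<mu> + vec_rmult x1 \<nu>)"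
      then have i: "i < k" using x1 by simp
      have "?N12 *\<^sub>v 0\<^sub>v r = 0\<^sub>v k" by (rule eq_vecI) auto
      then show "(?L *\<^sub>v y1 + (?B *\<^sub>v x1 + ?N12 *\<^sub>v 0\<^sub>v r)) $ i = (vec_rmult y1 \<mu> + vec_rmult x1 \<nu>) $ i"
        using y1(2)[OF i] i x1 y1 by (simp add: Lv[OF y1(1)] algebra_simps del: index_mult_mat_vec)
    qed (use x1 y1 in auto)
    moreover have "J *\<^sub>v y2 + (?N21 *\<^sub>v x1 + ?N22 *\<^sub>v 0\<^sub>v r) = vec_rmult y2 \<mu> + vec_rmult (0\<^sub>v r) \<nu>"
    proof -
      have "?N22 *\<^sub>v 0\<^sub>v r = 0\<^sub>v r" "vec_rmult (0\<^sub>v r) \<nu> = 0\<^sub>v r" by (rule eq_vecI; auto)+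
      then show ?thesis using y2 N21 by (simp add: right_zero_vec[of _ r])
    qed
    moreover have car: "?L *\<^sub>v y1 \<in> carrier_vec k" "?B *\<^sub>v x1 + ?N12 *\<^sub>v 0\<^sub>v r \<in> carrier_vec k"
      "J *\<^sub>v y2 \<in> carrier_vec r" "?N21 *\<^sub>v x1 + ?N22 *\<^sub>v 0\<^sub>v r \<in> carrier_vec r"
      using carrier_matD(1)[OF J] by (intro carrier_vecI, simp)+
    moreover have car': "vec_rmult y1 \<mu> \<in> carrier_vec k" "vec_rmult x1 \<nu> \<in> carrier_vec k"
      "vec_rmult y2 \<mu> \<in> carrier_vec r" "vec_rmult (0\<^sub>v r) \<nu> \<in> carrier_vec r"
      using x1(1) y1(1) y2(1) by simp_all
    ultimately have eq2: "?D *\<^sub>v ?y + N *\<^sub>v ?x = vec_rmult ?y \<mu> + vec_rmult ?x \<nu>"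
      unfolding Dv[OF y1(1) y2(1)] Nv[OF x1(1) z] rm
        append_vec_add[OF car] append_vec_add[OF car'] by (simp only:)
    show "dual_eigenpair (k + r) ?D N \<mu> \<nu>"
      unfolding dual_eigenpair_def using eq1 eq2 xne x1 y1 y2
      by (intro bexI[of _ ?x] bexI[of _ ?y]) auto
  qed
qed

section \<open>Solving the compressed equation\<close>

lemma sim_class_conj: "u * v = 1 \<Longrightarrow> v * u = 1 \<Longrightarrow> v * q * u \<in> sim_class q"
  by (auto simp: sim_class_def)

lemma sim_class_sym: "p \<in> sim_class q \<Longrightarrow> q \<in> sim_class p"
  unfolding sim_class_def
  by clarsimp (metis (no_types, lifting) mult.assoc mult.left_neutral mult.right_neutral)

lemma sim_class_trans: assumes "p \<in> sim_class q" "q \<in> sim_class r" shows "p \<in> sim_class r"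
proof -
  obtain u v u' v' where *: "u * v = 1" "v * u = 1" "p = v * q * u"
    "u' * v' = 1" "v' * u' = 1" "q = v' * r * u'"
    using assms by (auto simp: sim_class_def)
  have "(u' * u) * (v * v') = u' * (u * v) * v'" "(v * v') * (u' * u) = v * (v' * u') * u"
    by (simp_all only: mult.assoc)
  then have "(u' * u) * (v * v') = 1" "(v * v') * (u' * u) = 1"
    by (simp_all add: *)
  moreover have "p = (v * v') * r * (u' * u)"
    by (simp only: *(3,6) mult.assoc)
  ultimately show ?thesis unfolding sim_class_def by blast
qed

lemma sim_class_eq: "p \<in> sim_class q \<Longrightarrow> sim_class p = sim_class q"
  using sim_class_trans sim_class_sym by blast

text \<open>
  For real \<open>z\<close> everything commutes with \<open>z\<close>, and the compressed
  equation says that \<open>\<nu>\<close> is a right eigenvalue of \<open>B\<close>. Those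
  exist and are, up to similarity, the finitely many diagonal entries of the Jordan form of
  \<open>B\<close>; conjugating by a quaternion does not move the real standard part.
\<close>

lemma compressed_eigenvalues_real:
  assumes B: "B \<in> carrier_mat k k" and k: "0 < k" and real: "Im z = 0"
  defines "Z \<equiv> quat_of_complex z"
  shows "\<exists>F. finite F \<and> (\<forall>\<nu>. compressed_eigenpair k B Z \<nu> \<longrightarrow>
      (\<exists>a\<in>F. DQuat Z (quat_of_complex a) \<in> sim_class (DQuat Z \<nu>))) \<and> (\<exists>\<nu>. compressed_eigenpair k B Z \<nu>)"
proof -
  have comm: "q * Z = Z * q" for q
    unfolding Z_def by (rule quat_of_complex_commute_real[OF real])
  have iff: "compressed_eigenpair k B Z \<nu> \<longleftrightarrow> right_eigenvalue B \<nu>" for \<nu>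
  proof
    assume "compressed_eigenpair k B Z \<nu>"
    then obtain y where y: "y \<in> carrier_vec k" "y \<noteq> 0\<^sub>v k" "\<And>i. i < k \<Longrightarrow> (B *\<^sub>v y) $ i = y $ i * \<nu>"
      unfolding compressed_eigenpair_def by (auto simp: comm)
    then have "B *\<^sub>v y = vec_rmult y \<nu>"
      by (intro eq_vecI) (use B in \<open>auto simp del: index_mult_mat_vec\<close>)
    then show "right_eigenvalue B \<nu>" using y B unfolding right_eigenvalue_def by auto
  next
    assume "right_eigenvalue B \<nu>"
    then obtain y where y: "y \<in> carrier_vec k" "y \<noteq> 0\<^sub>v k" "B *\<^sub>v y = vec_rmult y \<nu>"
      using B unfolding right_eigenvalue_def by auto
    then show "compressed_eigenpair k B Z \<nu>"
      unfolding compressed_eigenpair_def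
      by (intro bexI[of _ y] bexI[of _ "0\<^sub>v k"]) (auto simp: comm simp del: index_mult_mat_vec)
  qed
  obtain bs where bs: "\<forall>(k, z) \<in> set bs. 0 < k \<and> 0 \<le> Im z" and sim: "similar_mat B (quat_jordan_matrix bs)"
    using quat_jordan_form_exists[OF B] by blast
  have "bs \<noteq> []" using similar_mat_dim_row[OF sim] B k by auto
  then obtain l w where lw: "(l, w) \<in> set bs" by (metis list.set_intros(1) neq_Nil_conv surj_pair)
  then have "right_eigenvalue (quat_jordan_matrix bs) (quat_of_complex w)"
    using bs by (intro quat_jordan_matrix_right_eigenvalue) auto
  then have ex: "right_eigenvalue B (quat_of_complex w)"
    using right_eigenvalue_similar[OF similar_mat_sym[OF sim]] by blast
  have "\<exists>a \<in> snd ` set bs. DQuat Z (quat_of_complex a) \<in> sim_class (DQuat Z \<nu>)"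
    if "right_eigenvalue B \<nu>" for \<nu>
  proof -
    obtain a u where a: "a \<in> snd ` set bs" and u: "u \<noteq> 0" "quat_of_complex a * u = u * \<nu>"
      using jordan_right_eigenvalue_cases[OF sim \<open>right_eigenvalue B \<nu>\<close>] by blast
    have "quat_of_complex a = quat_of_complex a * u * inverse u" using u(1) by (simp add: mult.assoc)
    then have "quat_of_complex a = u * \<nu> * inverse u" using u(2) by simp
    moreover have "u * Z * inverse u = Z" using u(1) by (simp add: comm mult.assoc)
    ultimately have "DQuat Z (quat_of_complex a) = DQuat u 0 * DQuat Z \<nu> * DQuat (inverse u) 0"
      by (simp add: times_dquat_def)
    moreover have "DQuat u 0 * DQuat (inverse u) 0 = 1" "DQuat (inverse u) 0 * DQuat u 0 = 1"
      using u(1) by (simp_all add: times_dquat_def one_dquat_def)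
    ultimately have "DQuat Z (quat_of_complex a) \<in> sim_class (DQuat Z \<nu>)"
      by (metis sim_class_conj)
    then show ?thesis using a by blast
  qed
  then show ?thesis using iff ex by (intro exI[of _ "snd ` set bs"]) blast
qed

text \<open>
  For nonreal \<open>z\<close> the quaternions commuting with \<open>z\<close> are the complex
  numbers, and $z w - w z$ ranges over $\mathbb{C} j$. With $B = B_1 + B_2 j$ and $\nu = a + b
  j$ the complex part of the compressed equation is $B_1 y = a y$, while the $j$-part can be
  solved for $w$ whatever $b$ is. So $a$ ranges over the spectrum of the complex matrix $B_1$,
  and $b$ is removed by conjugation with $1 + v\epsilon$ for a suitable $v \in \mathbb{C} j$.
\<close>

lemma compressed_eigenvalues_nonreal:
  assumes B: "B \<in> carrier_mat k k" and k: "0 < k" and nonreal: "Im z \<noteq> 0"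
  defines "Z \<equiv> quat_of_complex z"
  shows "\<exists>F. finite F \<and> (\<forall>\<nu>. compressed_eigenpair k B Z \<nu> \<longrightarrow>
      (\<exists>a\<in>F. DQuat Z (quat_of_complex a) \<in> sim_class (DQuat Z \<nu>))) \<and> (\<exists>\<nu>. compressed_eigenpair k B Z \<nu>)"
proof -
  define B1 where "B1 i j = Complex (qre (B $$ (i, j))) (qim_i (B $$ (i, j)))" for i j
  define B2 where "B2 i j = Complex (qim_j (B $$ (i, j))) (qim_k (B $$ (i, j)))" for i j
  have B12: "B $$ (i, j) = quat_pair (B1 i j) (B2 i j)" for i j
    by (simp add: quat_pair_def B1_def B2_def)
  let ?C = "mat k k (\<lambda>(i, j). B1 i j)"
  have C: "?C \<in> carrier_mat k k" by simp
  have ne: "z - cnj z \<noteq> 0" using nonreal by (auto simp: complex_eq_iff)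
  have Bv: "(B *\<^sub>v vec k (\<lambda>j. quat_pair (p j) 0)) $ i
      = quat_pair (\<Sum>j\<in>{0..<k}. B1 i j * p j) (\<Sum>j\<in>{0..<k}. B2 i j * cnj (p j))" if "i < k" for p i
    using that B by (simp add: scalar_prod_def B12 sum_quat_pair)
  have Zw: "Z * quat_pair a b - quat_pair a b * Z = quat_pair 0 ((z - cnj z) * b)" for a b
    by (simp add: Z_def quat_of_complex_eq_pair algebra_simps)
  have fin: "finite (spectrum ?C)" by (rule card_finite_spectrum[OF C])
  have "\<exists>a \<in> spectrum ?C. DQuat Z (quat_of_complex a) \<in> sim_class (DQuat Z \<nu>)"
    if pair: "compressed_eigenpair k B Z \<nu>" for \<nu>
  proof -
    obtain y w where y: "y \<in> carrier_vec k" "y \<noteq> 0\<^sub>v k" "\<And>i. i < k \<Longrightarrow> Z * y $ i = y $ i * Z"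
      and w: "\<And>i. i < k \<Longrightarrow> Z * w $ i - w $ i * Z + (B *\<^sub>v y) $ i = y $ i * \<nu>"
      using pair unfolding compressed_eigenpair_def by blast
    define p where "p i = Complex (qre (y $ i)) (qim_i (y $ i))" for i
    have yp: "y $ i = quat_pair (p i) 0" if "i < k" for i
    proof -
      obtain a b where ab: "y $ i = quat_pair a b" by (rule quat_pair_cases)
      have "quat_pair 0 ((z - cnj z) * b) = 0"
        using y(3)[OF that] Zw[of a b] unfolding ab by simp
      then have "b = 0" using ne by (simp add: zero_quat_eq_pair)
      moreover have "p i = a" unfolding p_def ab by (simp add: quat_pair_def)
      ultimately show ?thesis using ab by simp
    qed
    have yv: "y = vec k (\<lambda>j. quat_pair (p j) 0)" using y(1) yp by (intro eq_vecI) auto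
    obtain a b where \<nu>: "\<nu> = quat_pair a b" by (rule quat_pair_cases)
    have "(\<Sum>j\<in>{0..<k}. B1 i j * p j) = a * p i" if "i < k" for i
    proof -
      obtain c d where cd: "w $ i = quat_pair c d" by (rule quat_pair_cases)
      show ?thesis
        using w[OF that] unfolding yv Bv[OF that] cd Zw \<nu> using that by (simp add: mult.commute)
    qed
    then have "?C *\<^sub>v vec k p = a \<cdot>\<^sub>v vec k p"
      by (intro eq_vecI) (auto simp: scalar_prod_def)
    moreover have "vec k p \<noteq> 0\<^sub>v k"
    proof
      assume "vec k p = 0\<^sub>v k"
      then have "p i = 0" if "i < k" for i using that by (metis index_vec index_zero_vec(1))
      then show False using y(2) unfolding yv by (auto simp: zero_quat_eq_pair[symmetric])
    qed
    ultimately have a: "a \<in> spectrum ?C"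
      unfolding spectrum_def eigenvalue_def eigenvector_def
      by (intro CollectI exI[of _ "vec k p"] conjI) simp_all
    define v where "v = quat_pair 0 (- b / (z - cnj z))"
    have "\<nu> + (Z * v - v * Z) = quat_of_complex a"
      unfolding v_def Zw \<nu> using ne by (simp add: quat_of_complex_eq_pair)
    then have "DQuat Z (quat_of_complex a) = DQuat 1 (- v) * DQuat Z \<nu> * DQuat 1 v"
      by (simp add: times_dquat_def algebra_simps)
    moreover have "DQuat 1 v * DQuat 1 (- v) = 1" "DQuat 1 (- v) * DQuat 1 v = 1"
      by (simp_all add: times_dquat_def one_dquat_def)
    ultimately have "DQuat Z (quat_of_complex a) \<in> sim_class (DQuat Z \<nu>)"
      by (metis sim_class_conj)
    then show ?thesis using a by blast
  qed
  moreover have "\<exists>\<nu>. compressed_eigenpair k B Z \<nu>"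
  proof -
    obtain a where "a \<in> spectrum ?C" using spectrum_non_empty[OF C k] by blast
    then obtain v where v: "v \<in> carrier_vec k" "v \<noteq> 0\<^sub>v k" "?C *\<^sub>v v = a \<cdot>\<^sub>v v"
      unfolding spectrum_def eigenvalue_def eigenvector_def by auto
    let ?y = "vec k (\<lambda>j. quat_pair (v $ j) 0)"
    let ?w = "vec k (\<lambda>i. quat_pair 0 (- (\<Sum>j\<in>{0..<k}. B2 i j * cnj (v $ j)) / (z - cnj z)))"
    have "?y \<noteq> 0\<^sub>v k"
    proof
      assume y0: "?y = 0\<^sub>v k"
      have "v $ i = 0" if "i < k" for i
        using arg_cong[OF y0, of "\<lambda>y. y $ i"] that by (simp add: zero_quat_eq_pair)
      then show False using v(1,2) by (auto intro!: eq_vecI)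
    qed
    moreover have "(\<Sum>j\<in>{0..<k}. B1 i j * v $ j) = a * v $ i" if "i < k" for i
      using arg_cong[OF v(3), of "\<lambda>u. u $ i"] that v(1) by (simp add: scalar_prod_def)
    then have "Z * ?w $ i - ?w $ i * Z + (B *\<^sub>v ?y) $ i = ?y $ i * quat_of_complex a" if "i < k" for i
      unfolding Bv[OF that] using that ne Zw
      by (simp add: quat_of_complex_eq_pair mult.commute del: quat_pair_mult quat_pair_diff)
        (simp add: mult.commute)
    moreover have "Z * ?y $ i = ?y $ i * Z" if "i < k" for i
      using that by (simp add: Z_def quat_of_complex_eq_pair)
    ultimately show ?thesis
      unfolding compressed_eigenpair_def
      by (intro exI[of _ "quat_of_complex a"] bexI[of _ ?y] bexI[of _ ?w]) (auto simp del: index_mult_mat_vec)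
  qed
  ultimately show ?thesis using fin by blast
qed

section \<open>Dual eigenvalues over a semisimple eigenvalue\<close>

lemma sum_list_eq_length_replicate:
  assumes "\<And>b. b \<in> set bs \<Longrightarrow> 0 < fst b \<and> snd b = (z :: complex)"
    and "sum_list (map fst bs) = length bs"
  shows "bs = replicate (length bs) (1 :: nat, z)"
  using assms
proof (induction bs)
  case (Cons b bs)
  have "length bs \<le> sum_list (map fst bs)"
    using Cons.prems(1) by (induction bs) force+
  moreover have "0 < fst b" "snd b = z" using Cons.prems(1) by auto
  ultimately have "b = (1, z)" "sum_list (map fst bs) = length bs"
    using Cons.prems(2) by (auto simp: prod_eq_iff)
  with Cons.IH Cons.prems(1) show ?case by simp
qed simp

lemma quat_jordan_matrix_replicate:
  "quat_jordan_matrix (replicate k (1, z)) = mat k k (\<lambda>(i, j). if i = j then quat_of_complex z else 0)"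
proof (induction k)
  case (Suc k)
  have sum: "sum_list (map fst (replicate k (1 :: nat, z))) = k" by (induction k) auto
  show ?case
    unfolding replicate_Suc quat_jordan_matrix_Cons Suc sum
    by (rule eq_matI) (auto simp: less_Suc_eq_0_disj split: if_splits)
qed (auto intro: eq_matI)

text \<open>
  Equal multiplicities force the Jordan blocks of \<open>z\<close> to have size one. Sorting
  them to the front gives the block form to which \<open>dual_eigenpair_block\<close> applies:
  no other block has the eigenvalue \<open>z\<close>.
\<close>

lemma semisimple_eigenvalue_compression:
  assumes M: "M \<in> carrier_mat n n" and N: "N \<in> carrier_mat n n"
    and std: "standard_eigenvalue M z" and mult: "alg_mult z M = geo_mult z M"
  shows "\<exists>k B. 0 < k \<and> B \<in> carrier_mat k k \<and>
    (\<forall>\<nu>. dual_eigenpair n M N (quat_of_complex z) \<nu> \<longleftrightarrow> compressed_eigenpair k B (quat_of_complex z) \<nu>)"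
proof -
  define bs where "bs = jordan_blocks M"
  have nf: "quat_jordan_nf M bs"
    unfolding bs_def jordan_blocks_def using quat_jordan_nf_exists[OF M] by (rule someI_ex)
  have z: "0 \<le> Im z" "right_eigenvalue M (quat_of_complex z)"
    using std by (auto simp: standard_eigenvalue_def)
  have sim: "similar_mat M (quat_jordan_matrix bs)" and pos: "\<And>b. b \<in> set bs \<Longrightarrow> 0 < fst b"
    and im: "\<And>b. b \<in> set bs \<Longrightarrow> 0 \<le> Im (snd b)"
    using nf unfolding quat_jordan_nf_def jordan_nf_def quat_jordan_matrix_def[symmetric]
    by (force simp: standard_eigenvalue_def)+
  define xs where "xs = filter (\<lambda>b. snd b = z) bs"
  define ys where "ys = filter (\<lambda>b. snd b \<noteq> z) bs"
  define k where "k = length xs"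
  have xs: "xs = replicate k (1, z)"
    unfolding k_def
  proof (rule sum_list_eq_length_replicate)
    show "sum_list (map fst xs) = length xs"
      using mult unfolding alg_mult_def geo_mult_def bs_def[symmetric] xs_def[symmetric] .
  qed (use pos in \<open>auto simp: xs_def\<close>)
  have ys: "\<forall>(k, w) \<in> set ys. 0 \<le> Im w \<and> w \<noteq> z"
    using im by (auto simp: ys_def)
  have "xs \<noteq> []"
  proof
    assume "xs = []"
    then have "\<forall>(k, w) \<in> set bs. 0 \<le> Im w \<and> w \<noteq> z"
      using im by (auto simp: xs_def filter_empty_conv)
    with quat_jordan_matrix_no_eigenvalue[OF z(1)] right_eigenvalue_similar[OF sim z(2)]
    show False by blast
  qed
  then have k: "0 < k" by (simp add: k_def)
  let ?J = "quat_jordan_matrix ys" and ?r = "sum_list (map fst ys)" and ?Z = "quat_of_complex z"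
  have sum: "sum_list (map fst xs) = k" unfolding xs by (induction k) auto
  let ?D = "four_block_mat (mat k k (\<lambda>(i, j). if i = j then ?Z else 0)) (0\<^sub>m k ?r) (0\<^sub>m ?r k) ?J"
  have D: "quat_jordan_matrix (xs @ ys) = ?D"
    unfolding quat_jordan_matrix_append sum by (simp only: xs quat_jordan_matrix_replicate)
  have "mset bs = mset (xs @ ys)" by (simp add: xs_def ys_def)
  then have "similar_mat M ?D"
    unfolding D[symmetric] by (rule similar_mat_trans[OF sim quat_jordan_matrix_mset])
  then obtain P Q where wit: "similar_mat_wit M ?D P Q" by (auto simp: similar_mat_def)
  note w = similar_mat_witD2[OF M wit]
  have n: "n = k + ?r"
    using similar_mat_dim_row[OF \<open>similar_mat M ?D\<close>] M by simp
  have N': "Q * N * P \<in> carrier_mat (k + ?r) (k + ?r)" using w(6,7) N n by auto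
  have "dual_eigenpair n M N ?Z \<nu> \<longleftrightarrow>
      compressed_eigenpair k (mat k k (\<lambda>(i, j). (Q * N * P) $$ (i, j))) ?Z \<nu>" for \<nu>
    unfolding dual_eigenpair_similar[OF M N wit] unfolding n
    by (rule dual_eigenpair_block[OF quat_jordan_matrix_carrier quat_jordan_matrix_no_eigenvalue[OF z(1) ys]
          quat_jordan_matrix_sylvester[OF z(1) ys] N'])
  with k show ?thesis
    by (intro exI[of _ k] exI[of _ "mat k k (\<lambda>(i, j). (Q * N * P) $$ (i, j))"]) auto
qed

lemma dual_right_eigenvalue_conj:
  assumes A: "A \<in> carrier_mat n n" and a: "dual_right_eigenvalue A a" and uv: "u * v = 1" "v * u = 1"
  shows "dual_right_eigenvalue A (v * a * u)"
proof -
  obtain x where x: "x \<in> carrier_vec n" "map_vec std_part x \<noteq> 0\<^sub>v n" "A *\<^sub>v x = vec_rmult x a"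
    using a A unfolding dual_right_eigenvalue_def appreciable_def by fastforce
  have "map_vec std_part (vec_rmult x u) \<noteq> 0\<^sub>v n"
  proof
    assume 0: "map_vec std_part (vec_rmult x u) = 0\<^sub>v n"
    have su: "std_part u * std_part v = 1" using arg_cong[OF uv(1), of std_part] by simp
    have "map_vec std_part x $ i = 0" if "i < n" for i
    proof -
      have "std_part (x $ i) * std_part u = 0"
        using arg_cong[OF 0, of "\<lambda>v. v $ i"] that x(1) by simp
      then have "std_part (x $ i) * (std_part u * std_part v) = 0"
        by (simp add: mult.assoc[symmetric])
      then show ?thesis using su that x(1) by simp
    qed
    then show False using x(1,2) by (auto intro!: eq_vecI)
  qed
  moreover have "A *\<^sub>v vec_rmult x u = vec_rmult (vec_rmult x u) (v * a * u)"
  proof -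
    have "x $ i * a * u = x $ i * u * (v * a * u)" for i
      using uv(1) by (metis mult.assoc mult.right_neutral)
    then show ?thesis
      unfolding mult_mat_vec_rmult[OF A x(1)] x(3) by (intro eq_vecI) auto
  qed
  ultimately show ?thesis
    unfolding dual_right_eigenvalue_def appreciable_def
    using A x(1) by (intro bexI[of _ "vec_rmult x u"]) auto
qed

theorem theorem3p2:
  fixes A :: "dquat mat" and n m :: nat and ev :: "nat \<Rightarrow> complex"
  assumes "A \<in> carrier_mat n n"
    and "1 \<le> m"
    and "bij_betw ev {1..m} {z. standard_eigenvalue (map_mat std_part A) z}"
    and "2 \<le> m \<Longrightarrow> cmod (ev 1) > cmod (ev 2)"
    and "\<And>i. 2 \<le> i \<Longrightarrow> i < m \<Longrightarrow> cmod (ev i) \<ge> cmod (ev (i + 1))"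
    and "alg_mult (ev 1) (map_mat std_part A) = geo_mult (ev 1) (map_mat std_part A)"
  shows "(\<exists>a. dual_right_eigenvalue A a \<and> std_part a = quat_of_complex (ev 1)) \<and>
         finite (sim_class ` {a. dual_right_eigenvalue A a \<and>
                                 std_part a \<in> sim_class (quat_of_complex (ev 1))})"
proof -
  let ?M = "map_mat std_part A" and ?N = "map_mat dual_part A" and ?Z = "quat_of_complex (ev 1)"
  note A = assms(1)
  have MN: "?M \<in> carrier_mat n n" "?N \<in> carrier_mat n n" using A by auto
  have std: "standard_eigenvalue ?M (ev 1)"
    using bij_betwE[OF assms(3)] assms(2) by auto
  obtain k B where k: "0 < k" and B: "B \<in> carrier_mat k k"
    and iff: "\<And>\<nu>. dual_eigenpair n ?M ?N ?Z \<nu> \<longleftrightarrow> compressed_eigenpair k B ?Z \<nu>"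
    using semisimple_eigenvalue_compression[OF MN std assms(6)] by blast
  obtain F where F: "finite F" and ex: "\<exists>\<nu>. compressed_eigenpair k B ?Z \<nu>"
    and repr: "\<And>\<nu>. compressed_eigenpair k B ?Z \<nu> \<Longrightarrow>
      \<exists>a\<in>F. DQuat ?Z (quat_of_complex a) \<in> sim_class (DQuat ?Z \<nu>)"
    using compressed_eigenvalues_real[OF B k] compressed_eigenvalues_nonreal[OF B k] by metis
  have dual: "dual_right_eigenvalue A (DQuat ?Z \<nu>) \<longleftrightarrow> compressed_eigenpair k B ?Z \<nu>" for \<nu>
    using dual_right_eigenvalue_iff[OF A, of "DQuat ?Z \<nu>"] iff by simp
  \<comment> \<open>conjugating by a quaternion reduces the standard part to the standard eigenvalue itself\<close>
  have "sim_class a \<in> (\<lambda>c. sim_class (DQuat ?Z (quat_of_complex c))) ` F"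
    if a: "dual_right_eigenvalue A a" and sa: "std_part a \<in> sim_class ?Z" for a
  proof -
    obtain u v where uv: "u * v = 1" "v * u = 1" "?Z = v * std_part a * u"
      using sim_class_sym[OF sa] by (auto simp: sim_class_def)
    have UV: "DQuat u 0 * DQuat v 0 = 1" "DQuat v 0 * DQuat u 0 = 1"
      using uv by (simp_all add: times_dquat_def one_dquat_def)
    let ?b = "DQuat v 0 * a * DQuat u 0"
    have b: "?b \<in> sim_class a" by (rule sim_class_conj[OF UV])
    have b': "?b = DQuat ?Z (dual_part ?b)" by (rule dquat.expand) (simp add: uv(3)[symmetric])
    have "dual_right_eigenvalue A ?b" by (rule dual_right_eigenvalue_conj[OF A a UV])
    then have "compressed_eigenpair k B ?Z (dual_part ?b)" using dual b' by metis
    then obtain c where c: "c \<in> F" "DQuat ?Z (quat_of_complex c) \<in> sim_class ?b"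
      using repr b' by metis
    then show ?thesis using sim_class_eq[OF sim_class_trans[OF c(2) b]] by blast
  qed
  then have "sim_class ` {a. dual_right_eigenvalue A a \<and> std_part a \<in> sim_class ?Z}
      \<subseteq> (\<lambda>c. sim_class (DQuat ?Z (quat_of_complex c))) ` F"
    by blast
  then have "finite (sim_class ` {a. dual_right_eigenvalue A a \<and> std_part a \<in> sim_class ?Z})"
    using F by (meson finite_imageI finite_subset)
  moreover have "\<exists>a. dual_right_eigenvalue A a \<and> std_part a = ?Z"
    using ex dual by (metis dquat.sel(1))
  ultimately show ?thesis by blast
qed

end
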